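(* Let $J$ be a radially symmetric kernel on $\mathbb{R}^N$ whose support is exactly $B_1=\{|x|\le 1\}$, let $u_0:\mathbb{R}^N\to\mathbb{R}$ be locally bounded, and let $c_0>0$ be arbitrary. Consider the problem $u_t=J\ast u-u$ in $\mathbb{R}^N\times(0,\infty)$ with $u(x,0)=u_0(x)$. Then: (i) If $|u_0(x)|\le c_0 e^{\alpha|x|\ln|x|}$ for some $0<\alpha<1$, then there exists a global solution of the problem. (ii) If $u_0(x)\ge c_0 e^{\beta|x|\ln|x|}$ for some $\beta>1$, then there exists no nonnegative solution of the problem. (iii) For any $0<\alpha<1$, there exists at most one solution of the problem such that $|u(x,t)|\le C(t)e^{\alpha|x|\ln|x|}$, where $C(\cdot)$ is locally bounded in $[0,\infty)$.
   Context: A kernel is a nonnegative symmetric continuous function $J:\mathbb{R}^N\to\mathbb{R}$ with $\int_{\mathbb{R}^N}J=1$; $\ast$ is convolution in the space variable. At $x=0$ the expression $|x|\ln|x|$ is read as $0$. "Solution" means strong solution: a function $u\in C^0([0,\infty);L^1_{\rm loc}(\mathbb{R}^N))$ such that $u_t, J\ast u\in L^1_{\rm loc}(\mathbb{R}^N\times\mathbb{R}_+)$, with $\mathbb{R}_+=(0,\infty)$, the equation $u_t=J\ast u-u$ holds in the $L^1_{\rm loc}$-sense, and $u(x,0)=u_0(x)$ for almost every $x\in\mathbb{R}^N$.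
   Formalization: The initial datum u_0 is additionally assumed Lebesgue measurable; without this (i) fails, since u(·,0) in L^1_loc with u(·,0)=u_0 a.e. forces measurability, and (ii), (iii) are vacuous for non-measurable u_0. *)

theory Defs
  imports "HOL-Analysis.Analysis"
begin

text \<open>
  The space \<open>\<real>\<^sup>N\<close> is an arbitrary type \<open>'a\<close> of class \<^class>\<open>euclidean_space\<close>, and space-time is
  \<open>'a \<times> real\<close>.  Elements of \<open>L\<^sup>1\<^sub>l\<^sub>o\<^sub>c\<close> are given by representatives, so pointwise statements about
  them are stated up to null sets of Lebesgue measure.
\<close>

definition tsupport :: "('a::topological_space \<Rightarrow> real) \<Rightarrow> 'a set" where
  "tsupport f = closure {x. f x \<noteq> 0}"

definition conv_kernel :: "('a::euclidean_space \<Rightarrow> real) \<Rightarrow> bool" where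
  "conv_kernel J \<longleftrightarrow>
     (\<forall>x. 0 \<le> J x) \<and> (\<forall>x. J (- x) = J x) \<and> continuous_on UNIV J \<and>
     has_bochner_integral lebesgue J 1"

definition radially_symmetric :: "('a::real_normed_vector \<Rightarrow> real) \<Rightarrow> bool" where
  "radially_symmetric J \<longleftrightarrow> (\<forall>x y. norm x = norm y \<longrightarrow> J x = J y)"

text \<open>
  Meaningful when the integrand is integrable; this always holds for \<open>J\<close> continuous with
  compact support and \<open>f\<close> locally integrable.
\<close>

definition space_conv :: "('a::euclidean_space \<Rightarrow> real) \<Rightarrow> ('a \<Rightarrow> real) \<Rightarrow> 'a \<Rightarrow> real" where
  "space_conv J f x = (LINT y|lebesgue. J (x - y) * f y)"

definition locally_integrable_on :: "('b::euclidean_space \<Rightarrow> real) \<Rightarrow> 'b set \<Rightarrow> bool" where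
  "locally_integrable_on f \<Omega> \<longleftrightarrow>
     (\<forall>K. compact K \<and> K \<subseteq> \<Omega> \<longrightarrow> f absolutely_integrable_on K)"

definition locally_bounded_on :: "('b::topological_space \<Rightarrow> real) \<Rightarrow> 'b set \<Rightarrow> bool" where
  "locally_bounded_on f S \<longleftrightarrow> (\<forall>K. compact K \<and> K \<subseteq> S \<longrightarrow> bounded (f ` K))"

text \<open>
  Class \<open>C\<^sup>n\<close> on the whole space, by iterating directional derivatives; differentiability is in
  the Frechet sense.
\<close>

primrec C_k :: "nat \<Rightarrow> ('b::real_normed_vector \<Rightarrow> real) \<Rightarrow> bool" where
  "C_k 0 f \<longleftrightarrow> continuous_on UNIV f"
| "C_k (Suc n) f \<longleftrightarrow>
     (\<forall>x. f differentiable (at x)) \<and> (\<forall>v. C_k n (\<lambda>x. frechet_derivative f (at x) v))"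

definition test_function :: "'b::real_normed_vector set \<Rightarrow> ('b \<Rightarrow> real) \<Rightarrow> bool" where
  "test_function \<Omega> \<phi> \<longleftrightarrow>
     (\<forall>n. C_k n \<phi>) \<and> compact (tsupport \<phi>) \<and> tsupport \<phi> \<subseteq> \<Omega>"

abbreviation spacetime :: "('a \<times> real) set" where
  "spacetime \<equiv> UNIV \<times> {0<..}"

text \<open>
  \<open>w\<close> is the distributional derivative \<open>u\<^sub>t\<close> on \<open>\<real>\<^sup>N \<times> (0,\<infinity>)\<close> and lies in \<open>L\<^sup>1\<^sub>l\<^sub>o\<^sub>c\<close>; the vector \<open>(0, 1)\<close>
  is the time direction.
\<close>

definition weak_time_derivative ::
    "('a::euclidean_space \<times> real \<Rightarrow> real) \<Rightarrow> ('a \<times> real \<Rightarrow> real) \<Rightarrow> bool" where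
  "weak_time_derivative u w \<longleftrightarrow>
     locally_integrable_on u spacetime \<and> locally_integrable_on w spacetime \<and>
     (\<forall>\<phi>. test_function spacetime \<phi> \<longrightarrow>
        (LINT p:spacetime|lebesgue. u p * frechet_derivative \<phi> (at p) (0, 1)) =
        - (LINT p:spacetime|lebesgue. w p * \<phi> p))"

text \<open>\<open>u \<in> C\<^sup>0([0,\<infinity>); L\<^sup>1\<^sub>l\<^sub>o\<^sub>c(\<real>\<^sup>N))\<close>, with \<open>L\<^sup>1\<^sub>l\<^sub>o\<^sub>c\<close> topologised by the seminorms of \<open>L\<^sup>1(K)\<close>, \<open>K\<close> compact.\<close>

definition continuous_L1loc :: "('a::euclidean_space \<Rightarrow> real \<Rightarrow> real) \<Rightarrow> bool" where
  "continuous_L1loc u \<longleftrightarrow>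
     (\<forall>t\<ge>0. locally_integrable_on (\<lambda>x. u x t) UNIV) \<and>
     (\<forall>K. compact K \<longrightarrow>
        (\<forall>t\<ge>0. ((\<lambda>s. LINT x:K|lebesgue. \<bar>u x s - u x t\<bar>) \<longlongrightarrow> 0) (at t within {0..})))"

definition strong_solution ::
    "('a::euclidean_space \<Rightarrow> real) \<Rightarrow> ('a \<Rightarrow> real) \<Rightarrow> ('a \<Rightarrow> real \<Rightarrow> real) \<Rightarrow> bool" where
  "strong_solution J u0 u \<longleftrightarrow>
     continuous_L1loc u \<and>
     locally_integrable_on (\<lambda>(x, t). space_conv J (\<lambda>y. u y t) x) spacetime \<and>
     (\<exists>u_t. weak_time_derivative (\<lambda>(x, t). u x t) u_t \<and>
        (AE (x, t) in lebesgue. 0 < t \<longrightarrow>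
           u_t (x, t) = space_conv J (\<lambda>y. u y t) x - u x t)) \<and>
     (AE x in lebesgue. u x 0 = u0 x)"

text \<open>The value at \<open>x = 0\<close> is \<open>1\<close>, i.e. \<open>|x| ln |x|\<close> is read as \<open>0\<close> there.\<close>

definition growth :: "real \<Rightarrow> 'a::real_normed_vector \<Rightarrow> real" where
  "growth a x = exp (a * norm x * ln (norm x))"

end

theory Submission
  imports Defs "HOL-Real_Asymp.Real_Asymp"
begin

text \<open>
  Write \<open>A f = J \<star> f\<close>.  The substitution \<open>v = e\<^sup>t u\<close> turns the equation into \<open>v\<^sub>t = A v\<close>, so that
  formally \<open>v(t) = \<Sum>\<^sub>k t\<^sup>k/k! A\<^sup>k u\<^sub>0\<close>.  Everything rests on one comparison: as \<open>J\<close> lives on the unit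
  ball, \<open>A\<^sup>k u\<^sub>0 (x)\<close> sees \<open>u\<^sub>0\<close> on the ball of radius \<open>|x| + k\<close> only, where \<open>e\<^bsup>\<alpha>|y| ln |y|\<^esup>\<close> is about
  \<open>k\<^bsup>\<alpha>k\<^esup>\<close>, and this has to compete with \<open>k! \<approx> k\<^sup>k\<close>.

  For \<open>\<alpha> < 1\<close> the factorial wins (\<open>growth_series_summable\<close>): the series converges locally
  uniformly and is a solution (\<open>sol_strong_solution\<close>); and the difference of two solutions,
  which after multiplication by \<open>e\<^sup>t\<close> is a fixed point of \<open>v \<mapsto> \<integral>\<^sub>0\<^sup>t A v\<close>, is bounded by the \<open>k\<close>-th
  term of such a series for every \<open>k\<close>, hence vanishes (\<open>solution_unique\<close>).

  For \<open>\<beta> > 1\<close> fix a unit vector \<open>e\<close> and \<open>c < 1\<close> with \<open>\<beta> c > 1\<close>.  Since the support of \<open>J\<close> reaches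
  the unit sphere, a positive mass \<open>\<eta>\<close> of \<open>J\<close> lies in \<open>{z. z \<bullet> e \<ge> c}\<close>, and \<open>k\<close> steps of this kind
  travel a distance at least \<open>c k\<close>.  For a nonnegative solution \<open>u\<close> and \<open>x \<bullet> e \<ge> 1\<close>, every term
  \<open>c\<^sub>0 (\<eta> t)\<^sup>k/k! e\<^bsup>\<beta> c k ln (c k)\<^esup>\<close> is therefore a lower bound for \<open>v(x,t)\<close>, and these terms are
  unbounded in \<open>k\<close> (\<open>no_nonneg_solution\<close>).

  These arguments work on the identity \<open>v(x,t) = u\<^sub>0(x) + \<integral>\<^sub>0\<^sup>t (A v)(x,s) ds\<close>, valid for every \<open>t\<close> and
  almost every \<open>x\<close>.  Strong solutions satisfy the equation only against test functions of
  space-time, so this identity (\<open>solution_integral_eq\<close>) must first be derived.  Testing with products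
  \<open>\<chi>(x) \<psi>(t) e\<^sup>t\<close> shows that \<open>t \<mapsto> \<integral> \<chi> v(t)\<close> has the weak derivative \<open>\<integral> \<chi> A v(t)\<close>; both are
  continuous, so the weak derivative integrates (\<open>weak_ode_imp_integral_eq\<close>), and smooth cutoffs
  \<open>\<chi>\<close> are numerous enough to recover the identity almost everywhere
  (\<open>AE_zero_of_test_integrals_zero\<close>).
\<close>

section \<open>Smooth test functions\<close>

lemma C_k_mono: "C_k n f \<Longrightarrow> m \<le> n \<Longrightarrow> C_k m f"
proof (induction m arbitrary: n f)
  case 0
  show ?case
  proof (cases n)
    case 0
    with "0.prems" show ?thesis by simp
  next
    case (Suc k)
    with "0.prems" have "\<And>x. f differentiable (at x)" by simp
    then show ?thesis
      by (simp add: continuous_on_eq_continuous_within differentiable_imp_continuous_within)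
  qed
next
  case (Suc m)
  then obtain k where "n = Suc k" "m \<le> k" by (cases n) auto
  with Suc show ?case by auto
qed

lemma C_k_continuous: "C_k n f \<Longrightarrow> continuous_on UNIV f"
  using C_k_mono[of n f 0] by simp

lemma C_k_add: "C_k n f \<Longrightarrow> C_k n g \<Longrightarrow> C_k n (\<lambda>x. f x + g x)"
proof (induction n arbitrary: f g)
  case 0
  then show ?case by (auto intro!: continuous_intros)
next
  case (Suc n)
  have "frechet_derivative (\<lambda>x. f x + g x) (at x) v
      = frechet_derivative f (at x) v + frechet_derivative g (at x) v" for x v
  proof -
    have "((\<lambda>x. f x + g x) has_derivative
        (\<lambda>v. frechet_derivative f (at x) v + frechet_derivative g (at x) v)) (at x)"
      using Suc.prems by (intro has_derivative_add) (auto simp: frechet_derivative_works)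
    from frechet_derivative_at[OF this] show ?thesis by metis
  qed
  with Suc show ?case by auto
qed

lemma C_k_mult: "C_k n f \<Longrightarrow> C_k n g \<Longrightarrow> C_k n (\<lambda>x. f x * g x)"
proof (induction n arbitrary: f g)
  case 0
  then show ?case by (auto intro!: continuous_intros)
next
  case (Suc n)
  have eq: "frechet_derivative (\<lambda>x. f x * g x) (at x) v
      = f x * frechet_derivative g (at x) v + frechet_derivative f (at x) v * g x" for x v
  proof -
    have "((\<lambda>x. f x * g x) has_derivative
        (\<lambda>v. f x * frechet_derivative g (at x) v + frechet_derivative f (at x) v * g x)) (at x)"
      using Suc.prems by (intro has_derivative_mult) (auto simp: frechet_derivative_works)
    from frechet_derivative_at[OF this] show ?thesis by metis
  qed
  have "C_k n f" "C_k n g" using Suc.prems C_k_mono[of "Suc n" _ n] by auto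
  then have "C_k n (\<lambda>x. f x * frechet_derivative g (at x) v + frechet_derivative f (at x) v * g x)" for v
    using Suc.prems by (intro C_k_add Suc.IH) auto
  with Suc.prems show ?case by (auto simp: eq)
qed

lemma C_k_const: "C_k n (\<lambda>x. c)"
  by (induction n arbitrary: c) (auto)

lemma C_k_prod:
  "(\<And>i. i \<in> I \<Longrightarrow> C_k n (f i)) \<Longrightarrow> C_k n (\<lambda>x. \<Prod>i\<in>I. f i x)"
  by (induction I rule: infinite_finite_induct) (auto intro: C_k_mult C_k_const)


text \<open>
  Only affine inner maps are needed: projections, shifts, scalings and coordinate functions.  The
  outer derivative is then evaluated at the fixed vector \<open>l v\<close>, so the induction stays inside the class.
\<close>

lemma C_k_affine_compose:
  fixes f :: "'c::real_normed_vector \<Rightarrow> real" and l :: "'b::real_normed_vector \<Rightarrow> 'c"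
  assumes "C_k n f" and l: "bounded_linear l"
  shows "C_k n (\<lambda>x. f (l x + c))"
  using assms(1)
proof (induction n arbitrary: f)
  case 0
  then have "continuous_on UNIV (f \<circ> (\<lambda>x. l x + c))"
    by (intro continuous_on_compose continuous_on_add continuous_on_const linear_continuous_on[OF l])
       (auto intro: continuous_on_subset)
  then show ?case by (simp add: o_def)
next
  case (Suc n)
  have d: "((\<lambda>x. f (l x + c)) has_derivative (\<lambda>v. frechet_derivative f (at (l x + c)) (l v))) (at x)" for x
  proof -
    have "((\<lambda>x. l x + c) has_derivative l) (at x)"
      by (auto intro!: derivative_eq_intros bounded_linear_imp_has_derivative[OF l])
    moreover have "(f has_derivative frechet_derivative f (at (l x + c))) (at (l x + c))"
      using Suc.prems by (simp add: frechet_derivative_works)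
    ultimately show ?thesis by (rule has_derivative_compose)
  qed
  have "frechet_derivative (\<lambda>x. f (l x + c)) (at x) v = frechet_derivative f (at (l x + c)) (l v)" for x v
    using frechet_derivative_at[OF d] by metis
  moreover have "C_k n (\<lambda>x. frechet_derivative f (at (l x + c)) (l v))" for v
    using Suc.IH[of "\<lambda>y. frechet_derivative f (at y) (l v)"] Suc.prems by simp
  ultimately show ?case using differentiableI[OF d] by auto
qed

lemma frechet_derivative_real:
  "(f has_real_derivative D) (at t) \<Longrightarrow> frechet_derivative f (at t) v = D * v"
  unfolding has_field_derivative_def using frechet_derivative_at by metis

lemma C_k_Suc_real:
  assumes d: "\<And>t. (f has_real_derivative f' t) (at t)" and "C_k n f'"
  shows "C_k (Suc n) f"
proof -
  have "f differentiable (at t)" for t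
    using d[of t] by (auto simp: has_field_derivative_def differentiable_def)
  moreover have "C_k n (\<lambda>t. f' t * v)" for v
    using assms(2) by (intro C_k_mult C_k_const)
  ultimately show ?thesis by (simp add: frechet_derivative_real[OF d])
qed

text \<open>
  A family of functions that is closed under differentiation consists of smooth functions.  The
  index type is arbitrary so that it can be the set of polynomials, as for the flat functions below.
\<close>

lemma C_k_derivative_chain:
  fixes F :: "'i \<Rightarrow> real \<Rightarrow> real"
  assumes F: "\<And>i t. (F i has_real_derivative F (s i) t) (at t)"
  shows "C_k n (F i)"
proof (induction n arbitrary: i)
  case 0
  show ?case using F by (auto simp: continuous_on_eq_continuous_within intro: DERIV_isCont)
next
  case (Suc n)
  show ?case using C_k_Suc_real[OF F Suc] .
qed

lemma C_k_exp: "C_k n (exp :: real \<Rightarrow> real)"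
  using C_k_derivative_chain[of "\<lambda>_::unit. exp" id n] by (auto intro: DERIV_exp)

text \<open>
  The functions \<open>p(1/t) e\<^bsup>-1/t\<^esup>\<close>, extended by zero to \<open>t \<le> 0\<close>.  Keeping the polynomial factor as a
  parameter makes the family closed under differentiation; the classical flat function is \<open>flat 1\<close>.
\<close>

definition flat :: "real poly \<Rightarrow> real \<Rightarrow> real" where
  "flat p t = (if t \<le> 0 then 0 else poly p (1 / t) * exp (- 1 / t))"

lemma flat_tendsto_0:
  fixes p :: "real poly"
  shows "((\<lambda>t. poly p (1 / t) * exp (- 1 / t)) \<longlongrightarrow> 0) (at_right 0)"
proof -
  have "((\<lambda>s. \<Sum>i\<le>degree p. coeff p i * (s ^ i / exp s)) \<longlongrightarrow> (\<Sum>i\<le>degree p. coeff p i * 0)) at_top"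
    by (intro tendsto_sum tendsto_mult tendsto_const tendsto_power_div_exp_0)
  then have "((\<lambda>s. poly p s * exp (- s)) \<longlongrightarrow> 0) at_top"
    by (simp add: poly_altdef sum_distrib_right exp_minus divide_inverse mult.assoc)
  from filterlim_compose[OF this filterlim_inverse_at_top_right]
  show ?thesis by (simp add: inverse_eq_divide)
qed

text \<open>
  Away from \<open>0\<close> this is the chain rule.  At \<open>0\<close> the difference quotient from the right is again of the
  form \<open>q(1/t) e\<^bsup>-1/t\<^esup>\<close>, with \<open>q = X p\<close>, and tends to \<open>0\<close>.
\<close>

lemma flat_has_derivative:
  "(flat p has_real_derivative flat ([:0, 0, 1:] * (p - pderiv p)) t) (at t)"
proof (cases "t = 0")
  case False
  show ?thesis
  proof (cases "t < 0")
    case True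
    have "((\<lambda>_. 0) has_real_derivative 0) (at t)" by simp
    then have "(flat p has_real_derivative 0) (at t)"
      by (rule has_field_derivative_transform_within_open[of _ _ _ "{..<0}"])
         (use True in \<open>auto simp: flat_def\<close>)
    then show ?thesis using True by (simp add: flat_def)
  next
    case 2: False
    with False have t: "t > 0" by simp
    have "((\<lambda>t. poly p (1 / t) * exp (- 1 / t)) has_real_derivative
        flat ([:0, 0, 1:] * (p - pderiv p)) t) (at t)"
      using t by (auto intro!: derivative_eq_intros DERIV_chain2[OF poly_DERIV]
          simp: flat_def field_simps power2_eq_square)
    then show ?thesis
      by (rule has_field_derivative_transform_within_open[of _ _ _ "{0<..}"])
         (use t in \<open>auto simp: flat_def\<close>)
  qed
next
  case True
  have "((\<lambda>t. (flat p t - flat p 0) / (t - 0)) \<longlongrightarrow> 0) (at 0)"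
  proof (rule filterlim_split_at)
    have "eventually (\<lambda>t. 0 = (flat p t - flat p 0) / (t - 0)) (at_left 0)"
      by (auto simp: eventually_at_filter flat_def)
    then show "((\<lambda>t. (flat p t - flat p 0) / (t - 0)) \<longlongrightarrow> 0) (at_left 0)"
      by (rule Lim_transform_eventually[OF tendsto_const])
    have "eventually (\<lambda>t. poly ([:0, 1:] * p) (1 / t) * exp (- 1 / t) =
        (flat p t - flat p 0) / (t - 0)) (at_right 0)"
      by (auto simp: eventually_at_filter flat_def)
    then show "((\<lambda>t. (flat p t - flat p 0) / (t - 0)) \<longlongrightarrow> 0) (at_right 0)"
      by (rule Lim_transform_eventually[OF flat_tendsto_0])
  qed
  then show ?thesis using True by (simp add: has_field_derivative_iff flat_def)
qed

lemma C_k_flat: "C_k n (flat p)"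
  by (rule C_k_derivative_chain[where F = flat, OF flat_has_derivative])

definition bump :: "real \<Rightarrow> real \<Rightarrow> real \<Rightarrow> real" where
  "bump a b t = flat 1 (t - a) * flat 1 (b - t)"

lemma C_k_bump: "C_k n (bump a b)"
proof -
  have "C_k n (\<lambda>t. flat 1 (t + (- a)) * flat 1 (- t + b))"
    by (intro C_k_mult C_k_affine_compose[OF C_k_flat, of "\<lambda>t. t"]
        C_k_affine_compose[OF C_k_flat, of "\<lambda>t. - t"] bounded_linear_ident bounded_linear_minus)
  then show ?thesis by (simp add: bump_def[abs_def])
qed

lemma flat_1_nonneg: "0 \<le> flat 1 t" and flat_1_le_1: "flat 1 t \<le> 1" 
  and flat_1_pos_iff: "0 < flat 1 t \<longleftrightarrow> 0 < t"
  by (auto simp: flat_def)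

lemma exists_smooth_bump:
  fixes a b :: real
  assumes "a < b"
  obtains h where "\<And>n. C_k n h" "\<And>t. 0 \<le> h t" "\<And>t. t \<notin> {a..b} \<Longrightarrow> h t = 0"
    "(h has_integral 1) {a..b}"
proof -
  have cont: "continuous_on A (bump a b)" for A
    using C_k_continuous[OF C_k_bump[of 0]] by (rule continuous_on_subset) simp
  define I where "I = integral {a..b} (bump a b)"
  have int: "(bump a b has_integral I) {a..b}"
    unfolding I_def by (intro integrable_integral integrable_continuous_real cont)
  have nn: "0 \<le> bump a b t" for t by (simp add: bump_def flat_1_nonneg)
  have "I \<noteq> 0"
  proof
    assume "I = 0"
    then have "bump a b ((a + b) / 2) = 0"
      using has_integral_0_cbox_imp_0[of a b "bump a b" "(a + b) / 2"] cont nn int assms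
      by (auto simp: box_real)
    moreover have "0 < flat 1 ((a + b) / 2 - a)" "0 < flat 1 (b - (a + b) / 2)"
      using assms by (auto simp: flat_1_pos_iff field_simps)
    ultimately show False by (simp add: bump_def)
  qed
  moreover have "0 \<le> I" using has_integral_nonneg[OF int] nn by blast
  ultimately have I: "0 < I" by simp
  show ?thesis
  proof
    show "C_k n (\<lambda>t. bump a b t * (1 / I))" for n by (intro C_k_mult C_k_bump C_k_const)
    show "0 \<le> bump a b t * (1 / I)" for t using nn[of t] I by simp
    show "bump a b t * (1 / I) = 0" if "t \<notin> {a..b}" for t
      using that by (auto simp: bump_def flat_def)
    show "((\<lambda>t. bump a b t * (1 / I)) has_integral 1) {a..b}"
      using has_integral_mult_left[OF int, of "1 / I"] I by simp
  qed
qed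

text \<open>
  As \<open>flat 1 (m d)\<close> tends to \<open>1\<close> for every \<open>d > 0\<close> as \<open>m\<close> grows, these smooth functions converge to
  the indicator of the open box, with \<open>1\<close> as a common bound.
\<close>

definition box_cutoff :: "nat \<Rightarrow> 'a::euclidean_space \<Rightarrow> 'a \<Rightarrow> 'a \<Rightarrow> real" where
  "box_cutoff n a b x =
     (\<Prod>i\<in>Basis. flat 1 (real (Suc n) * (x \<bullet> i - a \<bullet> i)) * flat 1 (real (Suc n) * (b \<bullet> i - x \<bullet> i)))"

lemma C_k_box_cutoff: "C_k k (box_cutoff n a b)"
proof -
  have "C_k k (\<lambda>x. \<Prod>i\<in>Basis. flat 1 (real (Suc n) * (x \<bullet> i) + - (real (Suc n) * (a \<bullet> i))) *
      flat 1 (- (real (Suc n) * (x \<bullet> i)) + real (Suc n) * (b \<bullet> i)))"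
    by (intro C_k_prod C_k_mult C_k_affine_compose[OF C_k_flat, of "\<lambda>x. real (Suc n) * (x \<bullet> _)"]
        C_k_affine_compose[OF C_k_flat, of "\<lambda>x. - (real (Suc n) * (x \<bullet> _))"]
        bounded_linear_minus bounded_linear_const_mult bounded_linear_inner_left)
  moreover have "(\<lambda>x. \<Prod>i\<in>Basis. flat 1 (real (Suc n) * (x \<bullet> i) + - (real (Suc n) * (a \<bullet> i))) *
      flat 1 (- (real (Suc n) * (x \<bullet> i)) + real (Suc n) * (b \<bullet> i))) = box_cutoff n a b"
    unfolding box_cutoff_def[abs_def] right_diff_distrib by (simp add: add.commute)
  ultimately show ?thesis by simp
qed

lemma box_cutoff_nonneg: "0 \<le> box_cutoff n a b x"
  unfolding box_cutoff_def by (intro prod_nonneg) (auto simp: flat_1_nonneg)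

lemma box_cutoff_le_1: "box_cutoff n a b x \<le> 1"
  unfolding box_cutoff_def by (intro prod_le_1) (auto simp: flat_1_nonneg flat_1_le_1 intro!: mult_le_one)

lemma box_cutoff_eq_0: "x \<notin> box a b \<Longrightarrow> box_cutoff n a b x = 0"
  unfolding box_cutoff_def
  by (rule prod_zero) (auto simp: box_def flat_def mult_le_0_iff not_less split: if_splits)

lemma box_cutoff_tendsto: "(\<lambda>n. box_cutoff n a b x) \<longlonglongrightarrow> indicator (box a b) x"
proof (cases "x \<in> box a b")
  case True
  have *: "(\<lambda>n. flat 1 (real (Suc n) * d)) \<longlonglongrightarrow> 1" if "d > 0" for d
  proof -
    have "(\<lambda>n. exp (- (inverse (real (Suc n)) * (1 / d)))) \<longlonglongrightarrow> exp (- (0 * (1 / d)))"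
      by (intro tendsto_intros LIMSEQ_inverse_real_of_nat)
    moreover have "flat 1 (real (Suc n) * d) = exp (- (inverse (real (Suc n)) * (1 / d)))" for n
    proof -
      have "0 < real (Suc n) * d" using that by simp
      then show ?thesis unfolding flat_def by (simp only: not_le[symmetric]) (simp add: field_simps)
    qed
    ultimately show ?thesis by simp
  qed
  have "(\<lambda>n. box_cutoff n a b x) \<longlonglongrightarrow> (\<Prod>i\<in>(Basis::'a set). 1 * 1)"
    unfolding box_cutoff_def using True by (intro tendsto_intros *) (auto simp: box_def)
  then show ?thesis using True by simp
qed (simp add: box_cutoff_eq_0)

section \<open>Testing against cutoffs, and Fubini for completed measures\<close>

lemma lebesgue_integrable_borel_rep:
  fixes f :: "'b::euclidean_space \<Rightarrow> real"
  assumes "integrable lebesgue f"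
  obtains f' where "f' \<in> borel_measurable borel" "integrable lborel f'" "AE x in lborel. f x = f' x"
    "integral\<^sup>L lebesgue f = integral\<^sup>L lborel f'"
proof -
  obtain f' where f': "f' \<in> borel_measurable lborel" "AE x in lborel. f x = f' x"
    using completion_ex_borel_measurable_real[of f lborel] assms by auto
  have meas: "f' \<in> borel_measurable lebesgue" using f'(1) by (rule measurable_completion)
  have ae: "AE x in lebesgue. f x = f' x" using f'(2) by (rule AE_completion)
  have "integrable lebesgue f'"
    using integrable_cong_AE[OF borel_measurable_integrable[OF assms] meas ae] assms by simp
  moreover have "integral\<^sup>L lebesgue f = integral\<^sup>L lebesgue f'"
    using integral_cong_AE[OF borel_measurable_integrable[OF assms] meas ae] .
  ultimately show ?thesis
    using that[of f'] f' by (simp add: integrable_completion integral_completion)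
qed

lemma indicator_box_lebesgue_measurable: "indicator (box a b) \<in> borel_measurable lebesgue"
  by (rule measurable_completion) simp

text \<open>
  The positive and the negative part of \<open>F\<close> are densities of two finite measures that agree on open
  boxes.  Boxes form an intersection-stable generator of the Borel sets, so the measures coincide and
  with them, almost everywhere, the densities.
\<close>

lemma AE_zero_of_box_integrals_zero:
  fixes F :: "'a::euclidean_space \<Rightarrow> real"
  assumes F: "integrable lebesgue F"
    and zero: "\<And>a b. (LINT x|lebesgue. indicator (box a b) x * F x) = 0"
  shows "AE x in lebesgue. F x = 0"
proof -
  obtain f where f: "f \<in> borel_measurable borel" "integrable lborel f" "AE x in lborel. F x = f x"
    using lebesgue_integrable_borel_rep[OF F] by metis
  have box0: "(LINT x|lborel. indicator (box a b) x * f x) = 0" for a b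
  proof -
    have "(LINT x|lborel. indicator (box a b) x * f x) = (LINT x|lebesgue. indicator (box a b) x * f x)"
      using f(1) by (intro integral_completion[symmetric]) auto
    also have "\<dots> = (LINT x|lebesgue. indicator (box a b) x * F x)"
    proof (rule integral_cong_AE)
      have "f \<in> borel_measurable lebesgue" using f(1) by (intro measurable_completion) simp
      then show "(\<lambda>x. indicator (box a b) x * f x) \<in> borel_measurable lebesgue"
        by (rule borel_measurable_times[OF indicator_box_lebesgue_measurable])
      show "(\<lambda>x. indicator (box a b) x * F x) \<in> borel_measurable lebesgue"
        by (rule borel_measurable_times[OF indicator_box_lebesgue_measurable borel_measurable_integrable[OF F]])
      show "AE x in lebesgue. indicator (box a b) x * f x = indicator (box a b) x * F x"
        using AE_completion[OF f(3)] by eventually_elim simp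
    qed
    finally show ?thesis using zero by simp
  qed
  note [measurable] = f(1)
  have em: "emeasure (density lborel (\<lambda>x. ennreal (g x))) (box a b)
      = ennreal (LINT x|lborel. indicator (box a b) x * max 0 (g x))" if "integrable lborel g"
    for g :: "'a \<Rightarrow> real" and a b
  proof -
    have [measurable]: "g \<in> borel_measurable borel" using borel_measurable_integrable[OF that] by simp
    have "emeasure (density lborel (\<lambda>x. ennreal (g x))) (box a b)
        = (\<integral>\<^sup>+x. ennreal (g x) * indicator (box a b) x \<partial>lborel)"
      by (subst emeasure_density) auto
    also have "\<dots> = (\<integral>\<^sup>+x. ennreal (indicator (box a b) x * max 0 (g x)) \<partial>lborel)"
      by (intro nn_integral_cong) (auto split: split_indicator simp: ennreal_neg max_def not_le)
    also have "\<dots> = ennreal (LINT x|lborel. indicator (box a b) x * max 0 (g x))"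
      using integrable_real_mult_indicator[of "box a b" lborel "\<lambda>x. max 0 (g x)"] that
      by (intro nn_integral_eq_integral) (auto simp: mult.commute)
    finally show ?thesis .
  qed
  have eq: "(LINT x|lborel. indicator (box a b) x * max 0 (f x))
      = (LINT x|lborel. indicator (box a b) x * max 0 (- f x))" for a b
  proof -
    have i: "integrable lborel (\<lambda>x. indicator (box a b) x * max 0 (f x))"
      "integrable lborel (\<lambda>x. indicator (box a b) x * max 0 (- f x))"
      using integrable_real_mult_indicator[of "box a b" lborel "\<lambda>x. max 0 (f x)"]
        integrable_real_mult_indicator[of "box a b" lborel "\<lambda>x. max 0 (- f x)"] f(2)
      by (auto simp: mult.commute)
    have "(LINT x|lborel. indicator (box a b) x * max 0 (f x))
      - (LINT x|lborel. indicator (box a b) x * max 0 (- f x))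
      = (LINT x|lborel. indicator (box a b) x * f x)"
      unfolding Bochner_Integration.integral_diff[OF i, symmetric]
      by (intro Bochner_Integration.integral_cong) (auto simp: max_def split: split_indicator)
    then show ?thesis using box0 by simp
  qed
  have "density lborel (\<lambda>x. ennreal (f x)) = density lborel (\<lambda>x. ennreal (- f x))"
  proof (rule measure_eqI_generator_eq)
    let ?E = "range (\<lambda>(a, b). box a b::'a set)"
    show "Int_stable ?E" by (auto simp: Int_stable_def box_Int_box)
    show "?E \<subseteq> Pow UNIV" "sets (density lborel (\<lambda>x. ennreal (f x))) = sigma_sets UNIV ?E"
      "sets (density lborel (\<lambda>x. ennreal (- f x))) = sigma_sets UNIV ?E"
      by (simp_all add: borel_eq_box)
    let ?A = "\<lambda>n::nat. box (- (real n *\<^sub>R One)) (real n *\<^sub>R One) :: 'a set"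
    show "range ?A \<subseteq> ?E" "(\<Union>i. ?A i) = UNIV"
      unfolding UN_box_eq_UNIV by auto
    show "emeasure (density lborel (\<lambda>x. ennreal (f x))) (?A i) \<noteq> \<infinity>" for i
      by (simp add: em[OF f(2)])
    show "emeasure (density lborel (\<lambda>x. ennreal (f x))) X = emeasure (density lborel (\<lambda>x. ennreal (- f x))) X"
      if X_box: "X \<in> ?E" for X
    proof -
      obtain a b where X: "X = box a b" using X_box by auto
      have "integrable lborel (\<lambda>x. - f x)" using f(2) by simp
      then show ?thesis unfolding X em[OF f(2)] by (subst em) (simp_all add: eq)
    qed
  qed
  then have "AE x in lborel. ennreal (f x) = ennreal (- f x)"
    by (intro sigma_finite_measure.density_unique[OF sigma_finite_lborel]) auto
  then have "AE x in lborel. f x = 0"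
  proof eventually_elim
    case (elim x)
    show ?case
    proof (cases "0 \<le> f x")
      case True
      then have "ennreal (- f x) = 0" by (simp add: ennreal_neg)
      with elim True show ?thesis by simp
    next
      case False
      then have "ennreal (f x) = 0" "0 < ennreal (- f x)" by (simp_all add: ennreal_neg)
      with elim show ?thesis by simp
    qed
  qed
  with f(3) have "AE x in lborel. F x = 0" by eventually_elim simp
  then show ?thesis by (rule AE_completion)
qed

text \<open>
  The fundamental lemma of the calculus of variations: dominated convergence passes from the
  cutoffs to the indicators of boxes.
\<close>

lemma AE_zero_of_test_integrals_zero:
  fixes F :: "'a::euclidean_space \<Rightarrow> real"
  assumes F: "locally_integrable_on F UNIV"
    and zero: "\<And>n a b. (LINT x|lebesgue. box_cutoff n a b x * F x) = 0"
  shows "AE x in lebesgue. F x = 0"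
proof -
  have int: "integrable lebesgue (\<lambda>x. indicator (cbox a b) x * F x)" for a b
    using F by (auto simp: locally_integrable_on_def set_integrable_def)
  have meas: "(\<lambda>x. indicator (box a b) x * F x) \<in> borel_measurable lebesgue" for a b
  proof -
    have "(\<lambda>x. indicator (box a b) x * (indicator (cbox a b) x * F x)) \<in> borel_measurable lebesgue"
      by (rule borel_measurable_times[OF indicator_box_lebesgue_measurable borel_measurable_integrable[OF int]])
    also have "(\<lambda>x. indicator (box a b) x * (indicator (cbox a b) x * F x))
        = (\<lambda>x. indicator (box a b) x * F x)"
      using box_subset_cbox[of a b] by (auto simp: fun_eq_iff split: split_indicator)
    finally show ?thesis .
  qed
  have intb: "integrable lebesgue (\<lambda>x. indicator (box a b) x * F x)" for a b
    by (rule Bochner_Integration.integrable_bound[OF int[of a b] meas])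
      (use box_subset_cbox[of a b] in \<open>auto split: split_indicator\<close>)
  have box0: "(LINT x|lebesgue. indicator (box a b) x * F x) = 0" for a b
  proof -
    have "(\<lambda>n. LINT x|lebesgue. box_cutoff n a b x * (indicator (box a b) x * F x))
        \<longlonglongrightarrow> (LINT x|lebesgue. indicator (box a b) x * (indicator (box a b) x * F x))"
    proof (rule integral_dominated_convergence[where w = "\<lambda>x. \<bar>indicator (box a b) x * F x\<bar>"])
      show "(\<lambda>x. box_cutoff n a b x * (indicator (box a b) x * F x)) \<in> borel_measurable lebesgue" for n
      proof (rule borel_measurable_times[OF measurable_completion meas])
        show "box_cutoff n a b \<in> borel_measurable lborel"
          using borel_measurable_continuous_onI[OF C_k_continuous[OF C_k_box_cutoff[of 0 n a b]]] by simp
      qed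
      show "AE x in lebesgue. (\<lambda>n. box_cutoff n a b x * (indicator (box a b) x * F x))
          \<longlonglongrightarrow> indicator (box a b) x * (indicator (box a b) x * F x)"
        by (intro AE_I2 tendsto_intros box_cutoff_tendsto)
      show "AE x in lebesgue. norm (box_cutoff n a b x * (indicator (box a b) x * F x))
          \<le> \<bar>indicator (box a b) x * F x\<bar>" for n
        using box_cutoff_nonneg[of n a b] box_cutoff_le_1[of n a b]
        by (auto simp: abs_mult intro!: mult_left_le_one_le)
      show "(\<lambda>x. indicator (box a b) x * (indicator (box a b) x * F x)) \<in> borel_measurable lebesgue"
        by (rule borel_measurable_times[OF indicator_box_lebesgue_measurable meas])
      show "integrable lebesgue (\<lambda>x. \<bar>indicator (box a b) x * F x\<bar>)" using intb by auto
    qed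
    moreover have "box_cutoff n a b x * (indicator (box a b) x * F x) = box_cutoff n a b x * F x" for n x
      by (auto split: split_indicator simp: box_cutoff_eq_0)
    moreover have "indicator (box a b) x * (indicator (box a b) x * F x) = indicator (box a b) x * F x" for x
      by (auto split: split_indicator)
    ultimately have "(\<lambda>n. 0) \<longlonglongrightarrow> (LINT x|lebesgue. indicator (box a b) x * F x)"
      using zero by simp
    then show ?thesis using LIMSEQ_const_iff by metis
  qed
  let ?A = "\<lambda>n::nat. box (- (real n *\<^sub>R One)) (real n *\<^sub>R One) :: 'a set"
  have "AE x in lebesgue. indicator (?A n) x * F x = 0" for n
  proof (rule AE_zero_of_box_integrals_zero[OF intb])
    fix a b :: 'a
    obtain c d where cd: "box a b \<inter> ?A n = box c d" unfolding box_Int_box by blast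
    have e: "indicator (box a b) x * (indicator (?A n) x * F x) = indicator (box c d) x * F x" for x
      unfolding cd[symmetric] by (auto split: split_indicator)
    then show "(LINT x|lebesgue. indicator (box a b) x * (indicator (?A n) x * F x)) = 0"
      by (simp only: e box0)
  qed
  then have "AE x in lebesgue. \<forall>n. indicator (?A n) x * F x = 0"
    unfolding AE_all_countable by blast
  then show ?thesis
  proof eventually_elim
    case (elim x)
    obtain n where "x \<in> ?A n" using UN_box_eq_UNIV by blast
    then show ?case using elim by (auto dest!: spec[of _ n])
  qed
qed

text \<open>
  Lebesgue measure on the product is a completion, so the slices of an integrable function are
  well behaved for almost every \<open>t\<close> only.  Fubini is applied to a Borel representative.  Knowing all slice
  integrals as a Borel function \<open>g\<close> settles the measurability of the outer integrand.
\<close>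

lemma lebesgue_fubini:
  fixes f :: "'a::euclidean_space \<times> real \<Rightarrow> real"
  assumes f: "integrable lebesgue f" and g: "g \<in> borel_measurable borel"
    and slice: "\<And>t. (LINT x|lebesgue. f (x, t)) = g t"
  shows "integral\<^sup>L lebesgue f = integral\<^sup>L lborel g"
proof -
  obtain f' where f': "f' \<in> borel_measurable borel" "integrable lborel f'" "AE x in lborel. f x = f' x"
    "integral\<^sup>L lebesgue f = integral\<^sup>L lborel f'"
    using lebesgue_integrable_borel_rep[OF f] by metis
  note [measurable] = f'(1)
  have [measurable]: "f' \<in> borel_measurable (borel \<Otimes>\<^sub>M borel)" using f'(1) by (simp add: borel_prod)
  have "integrable (lborel \<Otimes>\<^sub>M lborel) (\<lambda>(x, t). f' (x, t))"
    using f'(2) by (simp add: lborel_prod)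
  from lborel_pair.integral_snd[OF this]
  have "integral\<^sup>L lborel f' = (LINT t|lborel. LINT x|lborel. f' (x, t))"
    by (simp add: lborel_prod)
  also have "\<dots> = integral\<^sup>L lborel g"
  proof (rule integral_cong_AE)
    show "(\<lambda>t. LINT x|lborel. f' (x, t)) \<in> borel_measurable lborel" by measurable
    show "g \<in> borel_measurable lborel" using g by simp
    have "AE p in lborel \<Otimes>\<^sub>M lborel. f p = f' p" using f'(3) unfolding lborel_prod .
    then have "AE p in distr (lborel \<Otimes>\<^sub>M lborel) (lborel \<Otimes>\<^sub>M lborel) (\<lambda>(x, y). (y, x)). f p = f' p"
      by (subst (asm) lborel_pair.distr_pair_swap)
    then have "AE p in (lborel \<Otimes>\<^sub>M lborel). f (case p of (t, x) \<Rightarrow> (x, t)) = f' (case p of (t, x) \<Rightarrow> (x, t))"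
      by (rule AE_distrD[rotated]) auto
    from lborel_pair.AE_pair[OF this]
    show "AE t in lborel. (LINT x|lborel. f' (x, t)) = g t"
    proof eventually_elim
      case (elim t)
      then have ae: "AE x in lebesgue. f' (x, t) = f (x, t)" 
        by (intro AE_completion) auto
      have m: "(\<lambda>x. f' (x, t)) \<in> borel_measurable lborel" by measurable
      have m1: "(\<lambda>x. f' (x, t)) \<in> borel_measurable lebesgue" using m by (rule measurable_completion)
      have m2: "(\<lambda>x. f (x, t)) \<in> borel_measurable lebesgue"
        by (rule borel_measurable_AE[OF m1 ae])
      have "(LINT x|lborel. f' (x, t)) = (LINT x|lebesgue. f' (x, t))"
        using m by (intro integral_completion[symmetric]) simp
      also have "\<dots> = (LINT x|lebesgue. f (x, t))" by (rule integral_cong_AE[OF m1 m2 ae])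
      finally show ?case using slice by simp
    qed
  qed
  finally show ?thesis using f'(4) by simp
qed


section \<open>Integrating a weak derivative in time\<close>

lemma weighted_average_close:
  fixes V h :: "real \<Rightarrow> real"
  assumes "continuous_on {a..b} V" "continuous_on {a..b} h" "\<And>t. 0 \<le> h t" "(h has_integral 1) {a..b}"
    and close: "\<And>t. t \<in> {a..b} \<Longrightarrow> \<bar>V t - c\<bar> \<le> e"
  shows "\<bar>integral {a..b} (\<lambda>t. V t * h t) - c\<bar> \<le> e"
proof -
  have i: "((\<lambda>t. V t * h t) has_integral integral {a..b} (\<lambda>t. V t * h t)) {a..b}"
    by (intro integrable_integral integrable_continuous_real continuous_intros assms)
  have u: "((\<lambda>t. (c + e) * h t) has_integral (c + e) * 1) {a..b}"
    and l: "((\<lambda>t. (c - e) * h t) has_integral (c - e) * 1) {a..b}"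
    by (intro has_integral_mult_right assms)+
  have "V t * h t \<le> (c + e) * h t" "(c - e) * h t \<le> V t * h t" if "t \<in> {a..b}" for t
    using close[OF that] by (auto intro!: mult_right_mono assms)
  then have "integral {a..b} (\<lambda>t. V t * h t) \<le> (c + e) * 1" "(c - e) * 1 \<le> integral {a..b} (\<lambda>t. V t * h t)"
    using has_integral_le[OF i u] has_integral_le[OF l i] by auto
  then show ?thesis by simp
qed

text \<open>
  Any primitive is constant to the left and to the right of the support of \<open>h\<close>, and the two constants
  differ by the integral of \<open>h\<close>; so mean zero is what makes a primitive with compact support.
\<close>

lemma smooth_primitive_of_mean_zero:
  fixes h :: "real \<Rightarrow> real"
  assumes h: "\<And>n. C_k n h" and supp: "\<And>t. t \<notin> {a..b} \<Longrightarrow> h t = 0" and zero: "(h has_integral 0) {a..b}"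
    and ab: "a \<le> b"
  obtains \<psi> where "\<And>n. C_k n \<psi>" "\<And>t. (\<psi> has_real_derivative h t) (at t)"
    "\<And>t. t \<notin> {a..b} \<Longrightarrow> \<psi> t = 0"
proof -
  have cont: "continuous_on UNIV h" using C_k_continuous[OF h[of 0]] .
  then have "\<exists>F. \<forall>x::real. -\<infinity> < ereal x \<longrightarrow> ereal x < \<infinity> \<longrightarrow> (F has_vector_derivative h x) (at x)"
    by (intro einterval_antiderivative) (auto simp: continuous_on_eq_continuous_at)
  then obtain F where F: "\<And>x. (F has_real_derivative h x) (at x)"
    by (auto simp: has_real_derivative_iff_has_vector_derivative)
  have ftc: "(h has_integral (F y - F x)) {x..y}" if "x \<le> y" for x y
    using that F by (intro fundamental_theorem_of_calculus)
      (auto simp: has_real_derivative_iff_has_vector_derivative intro: has_vector_derivative_at_within)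
  have "F b = F a" using has_integral_unique[OF ftc[OF ab] zero] by simp
  define \<psi> where "\<psi> t = F t - F a" for t
  have d: "(\<psi> has_real_derivative h t) (at t)" for t
    unfolding \<psi>_def using F by (auto intro!: derivative_eq_intros)
  show ?thesis
  proof
    show "C_k n \<psi>" for n by (rule C_k_mono[OF C_k_Suc_real[OF d h[of n]]]) auto
    show "(\<psi> has_real_derivative h t) (at t)" for t by (rule d)
    show "\<psi> t = 0" if "t \<notin> {a..b}" for t
    proof (cases "t < a")
      case True
      have "(h has_integral 0) {t..a}"
        by (rule has_integral_spike_finite[of "{a}" _ _ "\<lambda>_. 0"]) (auto intro!: supp)
      from has_integral_unique[OF ftc this] True show ?thesis by (simp add: \<psi>_def)
    next
      case False
      with that have "t > b" by auto
      have "(h has_integral 0) {b..t}"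
        by (rule has_integral_spike_finite[of "{b}" _ _ "\<lambda>_. 0"]) (auto intro!: supp)
      from has_integral_unique[OF ftc this] \<open>t > b\<close> \<open>F b = F a\<close> show ?thesis by (simp add: \<psi>_def)
    qed
  qed
qed

text \<open>
  The function \<open>V = U - \<integral>\<^sub>0 W\<close> is continuous with vanishing weak derivative.  Testing it with a
  primitive of the difference of two narrow bumps, one just to the right of \<open>s\<close> and one just to the right
  of \<open>r\<close>, gives \<open>V s = V r\<close> up to the oscillation of \<open>V\<close> on these bumps.  Continuity extends this to the
  initial time, which test functions of the open half-line cannot see.
\<close>

lemma weak_ode_imp_integral_eq:
  fixes U W :: "real \<Rightarrow> real"
  assumes U: "continuous_on {0..} U" and W: "continuous_on {0..} W"
    and test: "\<And>\<psi> \<psi>' a b. \<lbrakk>0 < a; a \<le> b; \<And>n. C_k n \<psi>; \<And>n. C_k n \<psi>';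
        \<And>t. (\<psi> has_real_derivative \<psi>' t) (at t); \<And>t. t \<notin> {a..b} \<Longrightarrow> \<psi> t = 0\<rbrakk>
        \<Longrightarrow> integral {a..b} (\<lambda>t. U t * \<psi>' t) = - integral {a..b} (\<lambda>t. W t * \<psi> t)"
    and t: "0 \<le> t"
  shows "U t = U 0 + integral {0..t} W"
proof -
  define P where "P s = integral {0..s} W" for s
  define V where "V s = U s - P s" for s
  have P_deriv: "(P has_real_derivative W s) (at s within {0..c})" if "s \<in> {0..c}" for s c
    unfolding P_def using that W
    by (intro integral_has_real_derivative) (auto intro: continuous_on_subset)
  have P: "continuous_on {0..} P"
    unfolding continuous_on_eq_continuous_within
  proof
    fix s :: real assume s: "s \<in> {0..}"
    have "continuous (at s within {0..s+1}) P"
      using DERIV_continuous[OF P_deriv[of s "s + 1"]] s by simp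
    moreover have "at s within {0..} = at s within {0..s+1}"
      by (rule at_within_nhd[of _ "{s-1<..<s+1}"]) auto
    ultimately show "continuous (at s within {0..}) P" by simp
  qed
  have V: "continuous_on {0..} V" unfolding V_def by (intro continuous_intros U P)
  \<comment> \<open>Integration by parts for \<open>P\<close> turns the tested equation into a statement about \<open>V\<close> alone.\<close>
  have V_test: "integral {a..b} (\<lambda>t. V t * \<psi>' t) = 0"
    if "0 < a" "a \<le> b" "\<And>n. C_k n \<psi>" "\<And>n. C_k n \<psi>'" and
      d: "\<And>t. (\<psi> has_real_derivative \<psi>' t) (at t)" and supp: "\<And>t. t \<notin> {a..b} \<Longrightarrow> \<psi> t = 0" for \<psi> \<psi>' a b
  proof -
    have sub: "{a..b} \<subseteq> {0..}" "{a..b} \<subseteq> {0..b}" using that by auto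
    have c: "continuous_on {a..b} \<psi>" "continuous_on {a..b} \<psi>'"
      using C_k_continuous[OF that(3)[of 0]] C_k_continuous[OF that(4)[of 0]] by (auto intro: continuous_on_subset)
    have c': "continuous_on {a..b} U" "continuous_on {a..b} W" "continuous_on {a..b} P"
      using U W P sub by (auto intro: continuous_on_subset)
    \<comment> \<open>The support condition leaves the end points open; continuity of \<open>\<psi>\<close> covers them.\<close>
    have ends: "\<psi> a = 0" "\<psi> b = 0"
    proof -
      have "continuous_on UNIV \<psi>" using C_k_continuous[OF that(3)[of 0]] .
      then have cl: "closed {x. \<psi> x = 0}"
        by (intro closed_Collect_eq) auto
      have "closure {..<a} \<subseteq> {x. \<psi> x = 0}" "closure {b<..} \<subseteq> {x. \<psi> x = 0}"
        by (intro closure_minimal cl; auto intro!: supp)+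
      then show "\<psi> a = 0" "\<psi> b = 0" by auto
    qed
    have "((\<lambda>t. W t * \<psi> t + P t * \<psi>' t) has_integral (P b * \<psi> b - P a * \<psi> a)) {a..b}"
    proof (rule fundamental_theorem_of_calculus[OF \<open>a \<le> b\<close>])
      fix s assume s: "s \<in> {a..b}"
      have "(P has_real_derivative W s) (at s within {a..b})"
        using P_deriv[of s b] s sub by (auto intro: DERIV_subset)
      then have "((\<lambda>t. P t * \<psi> t) has_real_derivative W s * \<psi> s + P s * \<psi>' s) (at s within {a..b})"
        using has_field_derivative_at_within[OF d]
        by (auto intro!: derivative_eq_intros)
      then show "((\<lambda>t. P t * \<psi> t) has_vector_derivative W s * \<psi> s + P s * \<psi>' s) (at s within {a..b})"
        by (simp add: has_real_derivative_iff_has_vector_derivative)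
    qed
    then have "integral {a..b} (\<lambda>t. W t * \<psi> t + P t * \<psi>' t) = 0"
      using ends by (simp add: integral_unique)
    moreover have "integral {a..b} (\<lambda>t. W t * \<psi> t + P t * \<psi>' t)
        = integral {a..b} (\<lambda>t. W t * \<psi> t) + integral {a..b} (\<lambda>t. P t * \<psi>' t)"
      by (intro integral_add integrable_continuous_real continuous_intros c c')
    moreover have "integral {a..b} (\<lambda>t. V t * \<psi>' t)
        = integral {a..b} (\<lambda>t. U t * \<psi>' t) - integral {a..b} (\<lambda>t. P t * \<psi>' t)"
      unfolding V_def left_diff_distrib
      by (intro integral_diff integrable_continuous_real continuous_intros c c')
    ultimately show ?thesis using test[OF that] by simp
  qed
  have V_close: "\<exists>d>0. \<forall>r\<in>{s..s+d}. \<bar>V r - V s\<bar> \<le> e" if "0 < s" "0 < e" for s e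
  proof -
    have "s \<in> {0..}" using that by simp
    with V \<open>0 < e\<close> obtain d where d: "d > 0" "\<forall>r\<in>{0..}. dist r s < d \<longrightarrow> dist (V r) (V s) < e"
      unfolding continuous_on_iff by blast
    have "\<bar>V r - V s\<bar> \<le> e" if "r \<in> {s..s + d / 2}" for r
    proof -
      have "r \<in> {0..}" "dist r s < d" using that \<open>0 < s\<close> d(1) by (auto simp: dist_real_def)
      then show ?thesis using d(2) by (auto simp: dist_real_def intro: less_imp_le)
    qed
    then show ?thesis using d(1) by (intro exI[of _ "d / 2"]) auto
  qed
  have V_eq: "V s = V r" if s: "0 < s" "s < r" for s r
  proof (rule ccontr)
    assume "V s \<noteq> V r"
    \<comment> \<open>The two averages below are equal and within \<open>e\<close> of \<open>V s\<close> and \<open>V r\<close>, so any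
      fraction below one half gives a contradiction.\<close>
    define e where "e = \<bar>V s - V r\<bar> / 3"
    have e: "0 < e" using \<open>V s \<noteq> V r\<close> by (simp add: e_def)
    obtain d1 where d1: "0 < d1" "\<forall>q\<in>{s..s+d1}. \<bar>V q - V s\<bar> \<le> e" using V_close[OF s(1) e] by auto
    obtain d2 where d2: "0 < d2" "\<forall>q\<in>{r..r+d2}. \<bar>V q - V r\<bar> \<le> e" using V_close[of r e] s e by auto
    obtain h1 where h1: "\<And>n. C_k n h1" "\<And>t. 0 \<le> h1 t" "\<And>t. t \<notin> {s..s+d1} \<Longrightarrow> h1 t = 0"
      "(h1 has_integral 1) {s..s+d1}" using exists_smooth_bump[of s "s + d1"] d1 by auto
    obtain h2 where h2: "\<And>n. C_k n h2" "\<And>t. 0 \<le> h2 t" "\<And>t. t \<notin> {r..r+d2} \<Longrightarrow> h2 t = 0"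
      "(h2 has_integral 1) {r..r+d2}" using exists_smooth_bump[of r "r + d2"] d2 by auto
    define b where "b = max (s + d1) (r + d2)"
    have sub: "{s..s+d1} \<subseteq> {s..b}" "{r..r+d2} \<subseteq> {s..b}" "s \<le> b" using s d1 d2 by (auto simp: b_def)
    have hs: "(h1 has_integral 1) {s..b}" "(h2 has_integral 1) {s..b}"
      using has_integral_on_superset[OF h1(4) h1(3) sub(1)] has_integral_on_superset[OF h2(4) h2(3) sub(2)] by auto
    have Ck: "C_k n (\<lambda>t. h1 t + h2 t * (-1))" for n by (intro C_k_add C_k_mult C_k_const h1 h2)
    obtain \<psi> where \<psi>: "\<And>n. C_k n \<psi>" "\<And>t. (\<psi> has_real_derivative h1 t + h2 t * (-1)) (at t)"
      "\<And>t. t \<notin> {s..b} \<Longrightarrow> \<psi> t = 0"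
    proof (rule smooth_primitive_of_mean_zero[OF Ck, of s b])
      show "h1 t + h2 t * - 1 = 0" if "t \<notin> {s..b}" for t
        using that sub h1(3)[of t] h2(3)[of t] by auto
      show "((\<lambda>t. h1 t + h2 t * - 1) has_integral 0) {s..b}"
        using has_integral_diff[OF hs] by simp
    qed (use sub that in auto)
    have c: "continuous_on A h1" "continuous_on A h2" for A
      using C_k_continuous[OF h1(1)[of 0]] C_k_continuous[OF h2(1)[of 0]] by (auto intro: continuous_on_subset)
    have cV: "continuous_on A V" if "A \<subseteq> {0..}" for A using V that by (rule continuous_on_subset)
    have "integral {s..b} (\<lambda>t. V t * (h1 t + h2 t * (-1))) = 0"
      by (rule V_test[OF _ _ \<psi>(1) Ck \<psi>(2,3)]) (use s sub in auto)
    moreover have "integral {s..b} (\<lambda>t. V t * (h1 t + h2 t * (-1)))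
        = integral {s..b} (\<lambda>t. V t * h1 t) - integral {s..b} (\<lambda>t. V t * h2 t)"
      using s by (subst integral_diff[symmetric])
        (auto simp: right_diff_distrib distrib_left intro!: integrable_continuous_real continuous_intros c cV)
    moreover have "integral {s..b} (\<lambda>t. V t * h1 t) = integral {s..s+d1} (\<lambda>t. V t * h1 t)"
    proof (rule integral_unique[OF has_integral_on_superset[OF integrable_integral _ sub(1)]])
      show "(\<lambda>t. V t * h1 t) integrable_on {s..s+d1}"
        using s by (intro integrable_continuous_real continuous_intros c cV) auto
      show "V t * h1 t = 0" if "t \<notin> {s..s+d1}" for t using h1(3)[OF that] by simp
    qed
    moreover have "integral {s..b} (\<lambda>t. V t * h2 t) = integral {r..r+d2} (\<lambda>t. V t * h2 t)"
    proof (rule integral_unique[OF has_integral_on_superset[OF integrable_integral _ sub(2)]])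
      show "(\<lambda>t. V t * h2 t) integrable_on {r..r+d2}"
        using s by (intro integrable_continuous_real continuous_intros c cV) auto
      show "V t * h2 t = 0" if "t \<notin> {r..r+d2}" for t using h2(3)[OF that] by simp
    qed
    moreover have "\<bar>integral {s..s+d1} (\<lambda>t. V t * h1 t) - V s\<bar> \<le> e"
      using s d1 by (intro weighted_average_close cV c h1) auto
    moreover have "\<bar>integral {r..r+d2} (\<lambda>t. V t * h2 t) - V r\<bar> \<le> e"
      using s d2 by (intro weighted_average_close cV c h2) auto
    ultimately have "\<bar>V s - V r\<bar> \<le> 2 * e" by linarith
    then show False using e by (simp add: e_def)
  qed
  have "V 0 = V (t + 1)"
  proof (rule continuous_constant_on_closure[of "{0<..}" V])
    show "continuous_on (closure {0<..}) V" using V by simp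
    show "V x = V (t + 1)" if "x \<in> {0<..}" for x
    proof (cases x "t + 1" rule: linorder_cases)
      case less
      then show ?thesis using V_eq[of x "t + 1"] that by simp
    next
      case greater
      then show ?thesis using V_eq[of "t + 1" x] t by simp
    qed simp
  qed simp
  moreover have "V t = V (t + 1)"
  proof (cases "t = 0")
    case True
    then show ?thesis using \<open>V 0 = V (t + 1)\<close> by (simp only:)
  next
    case False
    then show ?thesis using V_eq[of t "t + 1"] t by (simp only: less_le) simp
  qed
  ultimately show ?thesis by (simp add: V_def P_def)
qed

section \<open>Convolution with a kernel supported in the unit ball\<close>

lemma integral_abs_le_set_integral:
  fixes f g :: "'a::euclidean_space \<Rightarrow> real"
  assumes g: "integrable lebesgue g" and f: "f absolutely_integrable_on K"
    and le: "\<And>y. \<bar>g y\<bar> \<le> c * (indicator K y * \<bar>f y\<bar>)"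
  shows "\<bar>integral\<^sup>L lebesgue g\<bar> \<le> c * (LINT y:K|lebesgue. \<bar>f y\<bar>)"
proof -
  have "integrable lebesgue (\<lambda>y. \<bar>indicator K y *\<^sub>R f y\<bar>)"
    using f unfolding set_integrable_def by (rule integrable_abs)
  then have i: "integrable lebesgue (\<lambda>y. indicator K y * \<bar>f y\<bar>)" by (simp add: abs_mult)
  have "\<bar>integral\<^sup>L lebesgue g\<bar> \<le> (LINT y|lebesgue. \<bar>g y\<bar>)" by (rule integral_abs_bound)
  also have "\<dots> \<le> (LINT y|lebesgue. c * (indicator K y * \<bar>f y\<bar>))"
    using g i le by (intro integral_mono) auto
  also have "\<dots> = c * (LINT y:K|lebesgue. \<bar>f y\<bar>)" by (simp add: set_lebesgue_integral_def)
  finally show ?thesis .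
qed

lemma continuous_imp_lebesgue_measurable:
  fixes g :: "'b::euclidean_space \<Rightarrow> real"
  shows "continuous_on UNIV g \<Longrightarrow> g \<in> borel_measurable lebesgue"
  by (intro measurable_completion) (simp add: borel_measurable_continuous_onI)

lemma absolutely_integrable_times_continuous:
  fixes f g :: "'b::euclidean_space \<Rightarrow> real"
  assumes f: "f absolutely_integrable_on K" and K: "compact K" and g: "continuous_on UNIV g"
  shows "integrable lebesgue (\<lambda>y. indicator K y * (f y * g y))"
proof -
  have "compact (g ` K)" using K g by (meson compact_continuous_image continuous_on_subset top_greatest)
  then obtain B where B: "\<And>y. y \<in> K \<Longrightarrow> \<bar>g y\<bar> \<le> B"
    using compact_imp_bounded[of "g ` K"] unfolding bounded_iff by auto
  have f': "integrable lebesgue (\<lambda>y. indicator K y * f y)" using f by (simp add: set_integrable_def)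
  have m: "(\<lambda>y. (indicator K y * f y) * g y) \<in> borel_measurable lebesgue"
    by (rule borel_measurable_times[OF borel_measurable_integrable[OF f'] continuous_imp_lebesgue_measurable[OF g]])
  have "integrable lebesgue (\<lambda>y. (indicator K y * f y) * g y)"
  proof (rule Bochner_Integration.integrable_bound[OF _ m])
    show "integrable lebesgue (\<lambda>y. B * (indicator K y * f y))" using f' by simp
    show "AE y in lebesgue. norm (indicator K y * f y * g y) \<le> norm (B * (indicator K y * f y))"
    proof (rule AE_I2)
      fix y
      show "norm (indicator K y * f y * g y) \<le> norm (B * (indicator K y * f y))"
      proof (cases "y \<in> K")
        case True
        then have "\<bar>g y\<bar> \<le> \<bar>B\<bar>" using B[of y] by linarith
        then have "\<bar>f y\<bar> * \<bar>g y\<bar> \<le> \<bar>f y\<bar> * \<bar>B\<bar>" by (rule mult_left_mono) simp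
        then show ?thesis using True by (simp add: abs_mult mult.commute)
      qed simp
    qed
  qed
  then show ?thesis by (simp add: mult.assoc)
qed

lemma continuous_imp_locally_integrable:
  fixes g :: "'b::euclidean_space \<Rightarrow> real"
  assumes "continuous_on UNIV g"
  shows "locally_integrable_on g UNIV"
  unfolding locally_integrable_on_def
proof safe
  fix K :: "'b set" assume K: "compact K"
  have "integrable lborel (\<lambda>x. indicator K x *\<^sub>R g x)"
    using K assms by (intro borel_integrable_compact) (auto intro: continuous_on_subset)
  then have "integrable lebesgue (\<lambda>x. indicator K x *\<^sub>R g x)"
    by (subst integrable_completion) (auto dest: borel_measurable_integrable)
  then show "g absolutely_integrable_on K" by (simp add: set_integrable_def)
qed

lemma frechet_time_derivative:
  fixes \<phi> :: "'a::euclidean_space \<times> real \<Rightarrow> real"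
  assumes "\<phi> differentiable (at (x, t))"
  shows "((\<lambda>s. \<phi> (x, s)) has_real_derivative frechet_derivative \<phi> (at (x, t)) (0, 1)) (at t)"
proof -
  let ?D = "frechet_derivative \<phi> (at (x, t))"
  have D: "(\<phi> has_derivative ?D) (at (x, t))" using assms by (simp add: frechet_derivative_works)
  have "((\<lambda>s. (x, s)) has_derivative (\<lambda>h. (0, h))) (at t)"
    by (intro has_derivative_Pair has_derivative_const has_derivative_ident)
  from has_derivative_compose[OF this D]
  have d: "((\<lambda>s. \<phi> (x, s)) has_derivative (\<lambda>h. ?D (0, h))) (at t)" .
  have "(\<lambda>h. ?D (0, h)) = (*) (?D (0, 1))"
  proof
    fix h :: real
    have "?D (h *\<^sub>R (0, 1)) = h *\<^sub>R ?D (0, 1)"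
      by (rule linear_scale[OF has_derivative_linear[OF D]])
    moreover have "h *\<^sub>R (0, 1) = ((0, h) :: 'a \<times> real)" by simp
    ultimately show "?D (0, h) = ?D (0, 1) * h" by (metis mult.commute real_scaleR_def)
  qed
  then show ?thesis using d unfolding has_field_derivative_def by metis
qed

text \<open>
  Existence and uniqueness rest on the support lying inside the closed unit ball; that it reaches the
  unit sphere is an extra hypothesis of the blow-up result.
\<close>

locale dispersal_kernel =
  fixes J :: "'a::euclidean_space \<Rightarrow> real"
  assumes kernel_cont: "continuous_on UNIV J"
    and kernel_nonneg: "0 \<le> J z"
    and kernel_sym: "J (- z) = J z"
    and kernel_supp: "1 < norm z \<Longrightarrow> J z = 0"
    and kernel_mass: "has_bochner_integral lebesgue J 1"
begin

lemma kernel_bounded: obtains B where "0 < B" "\<And>z. J z \<le> B"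
proof -
  have "compact (J ` cball 0 1)"
    using kernel_cont by (intro compact_continuous_image) (auto intro: continuous_on_subset)
  then obtain B where B: "\<forall>z\<in>cball 0 1. \<bar>J z\<bar> \<le> B"
    using compact_imp_bounded[of "J ` cball 0 1"] unfolding bounded_iff by auto
  show ?thesis
  proof
    show "0 < \<bar>B\<bar> + 1" by simp
    show "J z \<le> \<bar>B\<bar> + 1" for z
      using B[rule_format, of z] kernel_supp[of z] by (cases "norm z \<le> 1") auto
  qed
qed

lemma kernel_shift_cont: "continuous_on UNIV (\<lambda>y. J (x - y))"
proof -
  have "continuous_on UNIV (J \<circ> (\<lambda>y. x - y))"
    using kernel_cont by (intro continuous_on_compose continuous_intros) (auto intro: continuous_on_subset)
  then show ?thesis by (simp add: o_def)
qed

lemma kernel_shift_eq_0: "y \<notin> cball x 1 \<Longrightarrow> J (x - y) = 0"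
  by (rule kernel_supp) (simp add: dist_norm)

lemma conv_integrable:
  assumes "locally_integrable_on f UNIV"
  shows "integrable lebesgue (\<lambda>y. J (x - y) * f y)"
proof -
  have "f absolutely_integrable_on cball x 1" using assms by (simp add: locally_integrable_on_def)
  from absolutely_integrable_times_continuous[OF this compact_cball kernel_shift_cont, of x]
  show ?thesis
    by (rule back_subst[of "integrable lebesgue"])
      (auto simp: fun_eq_iff kernel_shift_eq_0 split: split_indicator)
qed

text \<open>
  In space \<open>J \<star> u\<close> inherits the uniform continuity of \<open>J\<close>, and in time the continuity of \<open>u\<close> with values
  in \<open>L\<^sup>1\<close> of a ball.  This regularity is what turns almost-everywhere identities in space-time into
  identities for every \<open>t\<close>.
\<close>

lemma conv_jointly_continuous:
  assumes u: "continuous_L1loc u"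
  shows "continuous_on (UNIV \<times> {0..}) (\<lambda>(x, t). space_conv J (\<lambda>y. u y t) x)"
  unfolding continuous_on_iff
proof (intro ballI allI impI)
  fix p :: "'a \<times> real" and e :: real assume p: "p \<in> UNIV \<times> {0..}" and e: "0 < e"
  obtain x t where xt: "p = (x, t)" "0 \<le> t" using p by auto
  obtain B where B: "0 < B" "\<And>z. J z \<le> B" using kernel_bounded by blast
  let ?K = "cball x 2"
  have loc: "locally_integrable_on (\<lambda>x. u x s) UNIV" if "0 \<le> s" for s
    using u that by (simp add: continuous_L1loc_def)
  then have absi: "(\<lambda>x. u x s) absolutely_integrable_on K" if "0 \<le> s" "compact K" for s K
    using that by (simp add: locally_integrable_on_def)
  define I where "I = (LINT y:?K|lebesgue. \<bar>u y t\<bar>)"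
  have I: "0 \<le> I" unfolding I_def set_lebesgue_integral_def by (intro integral_nonneg_AE) auto
  have "uniformly_continuous_on (cball 0 3) J"
    using kernel_cont by (intro compact_uniformly_continuous) (auto intro: continuous_on_subset)
  moreover have "0 < e / (2 * (I + 1))" using e I by simp
  ultimately obtain d1 where d1: "0 < d1"
      "\<And>z z'. z \<in> cball 0 3 \<Longrightarrow> z' \<in> cball 0 3 \<Longrightarrow> dist z' z < d1 \<Longrightarrow> dist (J z') (J z) < e / (2 * (I + 1))"
    unfolding uniformly_continuous_on_def by blast
  have "((\<lambda>s. LINT y:?K|lebesgue. \<bar>u y s - u y t\<bar>) \<longlongrightarrow> 0) (at t within {0..})"
    using u xt by (simp add: continuous_L1loc_def)
  moreover have "0 < e / (2 * B)" using e B by simp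
  ultimately have "\<forall>\<^sub>F s in at t within {0..}. dist (LINT y:?K|lebesgue. \<bar>u y s - u y t\<bar>) 0 < e / (2 * B)"
    by (rule tendstoD)
  then obtain d2 where d2: "0 < d2"
      "\<And>s. 0 \<le> s \<Longrightarrow> s \<noteq> t \<Longrightarrow> dist s t < d2 \<Longrightarrow> \<bar>LINT y:?K|lebesgue. \<bar>u y s - u y t\<bar>\<bar> < e / (2 * B)"
    by (auto simp: eventually_at)
  have d2': "(LINT y:?K|lebesgue. \<bar>u y s - u y t\<bar>) < e / (2 * B)" if "0 \<le> s" "dist s t < d2" for s
    using d2(2)[OF that(1) _ that(2)] \<open>0 < e / (2 * B)\<close>
    by (cases "s = t") (auto simp: set_lebesgue_integral_def)
  show "\<exists>d>0. \<forall>p'\<in>UNIV \<times> {0..}. dist p' p < d \<longrightarrow>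
      dist (case p' of (x, t) \<Rightarrow> space_conv J (\<lambda>y. u y t) x) (case p of (x, t) \<Rightarrow> space_conv J (\<lambda>y. u y t) x) < e"
  proof (intro exI[of _ "min 1 (min d1 d2)"] conjI ballI impI)
    show "0 < min 1 (min d1 d2)" using d1 d2 by simp
    fix p' :: "'a \<times> real" assume p': "p' \<in> UNIV \<times> {0..}" and close: "dist p' p < min 1 (min d1 d2)"
    obtain x' s where xs: "p' = (x', s)" "0 \<le> s" using p' by auto
    have dx: "dist x' x < 1" "dist x' x < d1" and ds: "dist s t < d2"
      using close dist_fst_le[of p' p] dist_snd_le[of p' p] by (auto simp: xt xs)
    have i1: "integrable lebesgue (\<lambda>y. J (x' - y) * u y s)"
      and i2: "integrable lebesgue (\<lambda>y. J (x' - y) * u y t)"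
      and i3: "integrable lebesgue (\<lambda>y. J (x - y) * u y t)"
      using xt xs by (auto intro: conv_integrable loc)
    \<comment> \<open>The increment of the convolution splits into a change of \<open>u\<close> with the kernel at \<open>x'\<close>, and a
      change of the kernel with \<open>u\<close> at time \<open>t\<close>.  The radius \<open>2\<close> of \<open>?K\<close> covers the unit balls around all \<open>x'\<close>
      closer than \<open>1\<close> to \<open>x\<close>, and \<open>3\<close> bounds the arguments of \<open>J\<close> that then occur.\<close>
    have i12: "integrable lebesgue (\<lambda>y. J (x' - y) * (u y s - u y t))"
      using Bochner_Integration.integrable_diff[OF i1 i2] by (simp add: right_diff_distrib)
    have i23: "integrable lebesgue (\<lambda>y. (J (x' - y) - J (x - y)) * u y t)"
      using Bochner_Integration.integrable_diff[OF i2 i3] by (simp add: left_diff_distrib)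
    have "\<bar>LINT y|lebesgue. J (x' - y) * (u y s - u y t)\<bar> \<le> B * (LINT y:?K|lebesgue. \<bar>u y s - u y t\<bar>)"
    proof (rule integral_abs_le_set_integral[OF i12])
      show "(\<lambda>y. u y s - u y t) absolutely_integrable_on ?K"
        using xt xs by (intro set_integral_diff absi) auto
      show "\<bar>J (x' - y) * (u y s - u y t)\<bar> \<le> B * (indicator ?K y * \<bar>u y s - u y t\<bar>)" for y
      proof (cases "y \<in> cball x' 1")
        case True
        then have "y \<in> ?K" using dx dist_triangle[of x y x'] by (simp add: dist_commute)
        then show ?thesis using B(2)[of "x' - y"] kernel_nonneg[of "x' - y"]
          by (auto simp: abs_mult intro!: mult_right_mono)
      qed (use B in \<open>simp add: kernel_shift_eq_0\<close>)
    qed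
    also have "\<dots> < B * (e / (2 * B))" using d2'[OF xs(2) ds] B by (intro mult_strict_left_mono) auto
    finally have 1: "\<bar>LINT y|lebesgue. J (x' - y) * (u y s - u y t)\<bar> < e / 2" using B by simp
    have "\<bar>LINT y|lebesgue. (J (x' - y) - J (x - y)) * u y t\<bar> \<le> e / (2 * (I + 1)) * I"
      unfolding I_def
    proof (rule integral_abs_le_set_integral[OF i23], fold I_def)
      show "(\<lambda>y. u y t) absolutely_integrable_on ?K" using xt by (intro absi) auto
      show "\<bar>(J (x' - y) - J (x - y)) * u y t\<bar> \<le> e / (2 * (I + 1)) * (indicator ?K y * \<bar>u y t\<bar>)" for y
      proof (cases "y \<in> ?K")
        case True
        have "norm (x - y) \<le> 2" "norm (x' - x) < 1" using True dx by (simp_all add: dist_norm)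
        moreover have "norm (x' - y) \<le> norm (x' - x) + norm (x - y)" using norm_triangle_ineq[of "x' - x" "x - y"] by simp
        ultimately have "x' - y \<in> cball 0 3" "x - y \<in> cball 0 3" by auto
        moreover have "dist (x' - y) (x - y) < d1" using dx by (simp add: dist_norm)
        ultimately have "\<bar>J (x' - y) - J (x - y)\<bar> < e / (2 * (I + 1))"
          using d1(2) by (simp add: dist_real_def)
        from mult_right_mono[OF less_imp_le[OF this], of "\<bar>u y t\<bar>"] show ?thesis
          using True by (simp add: abs_mult)
      next
        case False
        then have "y \<notin> cball x 1" "y \<notin> cball x' 1"
          using dx dist_triangle[of x y x'] by (auto simp: dist_commute)
        then show ?thesis using False by (simp add: kernel_shift_eq_0)
      qed
    qed
    also have "\<dots> < e / 2"
    proof -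
      have "e * I < e * (I + 1)" using e by simp
      then show ?thesis using I by (simp add: field_simps)
    qed
    finally have 2: "\<bar>LINT y|lebesgue. (J (x' - y) - J (x - y)) * u y t\<bar> < e / 2" .
    have "space_conv J (\<lambda>y. u y s) x' - space_conv J (\<lambda>y. u y t) x
      = (LINT y|lebesgue. J (x' - y) * (u y s - u y t)) + (LINT y|lebesgue. (J (x' - y) - J (x - y)) * u y t)"
      unfolding space_conv_def right_diff_distrib left_diff_distrib
      using i1 i2 i3 by simp
    then show "dist (case p' of (x, t) \<Rightarrow> space_conv J (\<lambda>y. u y t) x)
        (case p of (x, t) \<Rightarrow> space_conv J (\<lambda>y. u y t) x) < e"
      using 1 2 by (simp add: xt xs dist_real_def)
  qed
qed


lemma kernel_borel: "J \<in> borel_measurable borel"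
  using kernel_cont by (rule borel_measurable_continuous_onI)

text \<open>
  Symmetry of \<open>J\<close> gives \<open>J (x - y) = J (y - x)\<close>, so that a translation suffices as change of variables.
\<close>

lemma kernel_shift_integral:
  assumes h: "h \<in> borel_measurable borel"
  shows "(LINT y|lebesgue. J (x - y) * h (y - x)) = (LINT z|lebesgue. J z * h z)"
proof -
  note [measurable] = h kernel_borel
  have "J (x - y) = J (- x + y)" for y using kernel_sym[of "x - y"] by simp
  then have "(LINT y|lebesgue. J (x - y) * h (y - x)) = (LINT y|lebesgue. J (- x + y) * h (- x + y))"
    by simp
  also have "\<dots> = (LINT y|lborel. J (- x + y) * h (- x + y))"
    by (intro integral_completion) measurable
  also have "\<dots> = (LINT z|distr lborel borel ((+) (- x)). J z * h z)"
    by (subst integral_distr) auto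
  also have "\<dots> = (LINT z|lborel. J z * h z)" by (simp add: lborel_distr_plus)
  also have "\<dots> = (LINT z|lebesgue. J z * h z)"
    by (intro integral_completion[symmetric]) measurable
  finally show ?thesis .
qed

lemma kernel_shift_mass: "(LINT y|lebesgue. J (x - y)) = 1"
  using kernel_shift_integral[of "\<lambda>_. 1" x] has_bochner_integral_integral_eq[OF kernel_mass] by simp

lemma kernel_shift_integrable: "integrable lebesgue (\<lambda>y. J (x - y))"
  using conv_integrable[OF continuous_imp_locally_integrable[OF continuous_on_const[of _ 1]]] by simp

text \<open>
  Averaging over the unit ball around \<open>x\<close>: a bound on \<open>f\<close> over the ball of radius \<open>|x| + 1\<close> passes to
  \<open>J \<star> f\<close> at \<open>x\<close>.  This is the step by which the \<open>k\<close>-th iterate looks out to radius \<open>|x| + k\<close>.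
\<close>

lemma conv_abs_le:
  assumes f: "locally_integrable_on f UNIV" and le: "AE y in lebesgue. norm y \<le> norm x + 1 \<longrightarrow> \<bar>f y\<bar> \<le> M"
  shows "\<bar>space_conv J f x\<bar> \<le> M"
proof -
  have i: "integrable lebesgue (\<lambda>y. J (x - y) * f y)" by (rule conv_integrable[OF f])
  have "\<bar>space_conv J f x\<bar> \<le> (LINT y|lebesgue. \<bar>J (x - y) * f y\<bar>)"
    unfolding space_conv_def by (rule integral_abs_bound)
  also have "\<dots> \<le> (LINT y|lebesgue. J (x - y) * M)"
  proof (rule integral_mono_AE)
    show "integrable lebesgue (\<lambda>y. \<bar>J (x - y) * f y\<bar>)" using i by auto
    show "integrable lebesgue (\<lambda>y. J (x - y) * M)" using kernel_shift_integrable by auto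
    show "AE y in lebesgue. \<bar>J (x - y) * f y\<bar> \<le> J (x - y) * M"
      using le
    proof eventually_elim
      case (elim y)
      show ?case
      proof (cases "y \<in> cball x 1")
        case True
        then have "norm y \<le> norm x + 1"
          using norm_triangle_ineq2[of y x] by (simp add: dist_norm norm_minus_commute)
        then show ?thesis using elim by (auto simp: abs_mult kernel_nonneg intro!: mult_left_mono)
      qed (simp add: kernel_shift_eq_0)
    qed
  qed
  also have "\<dots> = M" by (simp add: kernel_shift_mass)
  finally show ?thesis .
qed

lemma conv_scale: "space_conv J (\<lambda>y. c * f y) x = c * space_conv J f x"
  unfolding space_conv_def by (simp add: mult.left_commute)

lemma conv_continuous_time:
  assumes "continuous_L1loc u"
  shows "continuous_on {0..} (\<lambda>s. exp s * space_conv J (\<lambda>y. u y s) x)"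
proof -
  have "continuous_on {0..} (\<lambda>s. (\<lambda>(x, s). space_conv J (\<lambda>y. u y s) x) (x, s))"
    by (rule continuous_on_compose2[OF conv_jointly_continuous[OF assms]]) (auto intro!: continuous_intros)
  then show ?thesis by (intro continuous_intros) simp
qed


section \<open>The integral equation behind a strong solution\<close>

text \<open>
  Duhamel in integrated form for \<open>v = e\<^sup>t u\<close>.  The factor \<open>e\<^sup>t\<close> is put into the test function, where its
  derivative cancels the term \<open>-u\<close> of the equation.  With \<open>\<chi>\<close> fixed, \<open>U\<close> and \<open>W\<close> are the pairings of \<open>\<chi>\<close> with
  \<open>v\<close> and \<open>J \<star> v\<close>; integrating \<open>U' = W\<close> down to \<open>t = 0\<close> and exchanging the integrals leaves a function of
  \<open>x\<close> that is orthogonal to all cutoffs.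
\<close>

lemma solution_integral_eq:
  assumes sol: "strong_solution J u0 u" and t: "0 \<le> t"
  shows "AE x in lebesgue.
    exp t * u x t = u0 x + integral {0..t} (\<lambda>s. exp s * space_conv J (\<lambda>y. u y s) x)"
proof -
  have uL: "continuous_L1loc u"
    and convL: "locally_integrable_on (\<lambda>(x, t). space_conv J (\<lambda>y. u y t) x) spacetime"
    and init: "AE x in lebesgue. u x 0 = u0 x"
    using sol by (auto simp: strong_solution_def)
  obtain w where weak: "weak_time_derivative (\<lambda>(x, t). u x t) w"
    and w_eq: "AE (x, t) in lebesgue. 0 < t \<longrightarrow> w (x, t) = space_conv J (\<lambda>y. u y t) x - u x t"
    using sol by (auto simp: strong_solution_def)
  define L where "L x s = space_conv J (\<lambda>y. u y s) x" for x s
  have L_cont: "continuous_on (UNIV \<times> {0..}) (\<lambda>(x, s). L x s)"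
    unfolding L_def using conv_jointly_continuous[OF uL] .
  have loc: "locally_integrable_on (\<lambda>x. u x s) UNIV" if "0 \<le> s" for s
    using uL that by (simp add: continuous_L1loc_def)
  then have absi: "(\<lambda>x. u x s) absolutely_integrable_on K" if "0 \<le> s" "compact K" for s K
    using that by (simp add: locally_integrable_on_def)
  have cutoff_cont: "continuous_on A (box_cutoff n a b)" for n and a b :: 'a and A
    using C_k_continuous[OF C_k_box_cutoff[of 0 n a b]] by (rule continuous_on_subset) simp
  have cutoff_supp: "box_cutoff n a b x = indicator (cbox a b) x * box_cutoff n a b x" for n and a b x :: 'a
    using box_subset_cbox[of a b] box_cutoff_eq_0[of x a b n] by (auto split: split_indicator)
  have cut_int: "integrable lebesgue (\<lambda>x. box_cutoff n a b x * u x s)" if "0 \<le> s" for n and a b :: 'a and s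
    using absolutely_integrable_times_continuous[OF absi[OF that compact_cbox[of a b]] compact_cbox cutoff_cont[where n = n and a = a and b = b]]
    by (subst cutoff_supp) (simp add: ac_simps)

  define U where "U n a b s = exp s * (LINT x|lebesgue. box_cutoff n a b x * u x s)" for n and a b :: 'a and s
  define W where "W n a b s = integral (cbox a b) (\<lambda>x. box_cutoff n a b x * (exp s * L x s))" for n and a b :: 'a and s
  have U_cont: "continuous_on {0..} (U n a b)" for n a b
    unfolding U_def
  proof (intro continuous_on_mult continuous_on_exp continuous_on_id)
    show "continuous_on {0..} (\<lambda>s. LINT x|lebesgue. box_cutoff n a b x * u x s)"
      unfolding continuous_on_def
    proof
      fix s :: real assume s: "s \<in> {0..}"
      have lim: "((\<lambda>r. LINT x:cbox a b|lebesgue. \<bar>u x r - u x s\<bar>) \<longlongrightarrow> 0) (at s within {0..})"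
        using uL s by (simp add: continuous_L1loc_def)
      show "((\<lambda>s. LINT x|lebesgue. box_cutoff n a b x * u x s) \<longlongrightarrow>
          (LINT x|lebesgue. box_cutoff n a b x * u x s)) (at s within {0..})"
      proof (rule Lim_null[THEN iffD2], rule Lim_null_comparison[OF _ lim])
        have "\<bar>(LINT x|lebesgue. box_cutoff n a b x * u x r) - (LINT x|lebesgue. box_cutoff n a b x * u x s)\<bar>
            \<le> (LINT x:cbox a b|lebesgue. \<bar>u x r - u x s\<bar>)" if r: "0 \<le> r" for r
        proof -
          have i: "integrable lebesgue (\<lambda>x. box_cutoff n a b x * u x r - box_cutoff n a b x * u x s)"
            using r s by (intro Bochner_Integration.integrable_diff cut_int) auto
          have "\<bar>LINT x|lebesgue. box_cutoff n a b x * u x r - box_cutoff n a b x * u x s\<bar>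
              \<le> 1 * (LINT x:cbox a b|lebesgue. \<bar>u x r - u x s\<bar>)"
          proof (rule integral_abs_le_set_integral[OF i])
            show "(\<lambda>x. u x r - u x s) absolutely_integrable_on cbox a b"
              using r s by (intro set_integral_diff absi) auto
            fix x
            have "\<bar>box_cutoff n a b x * u x r - box_cutoff n a b x * u x s\<bar>
                = box_cutoff n a b x * \<bar>u x r - u x s\<bar>"
              by (simp add: right_diff_distrib[symmetric] abs_mult box_cutoff_nonneg)
            also have "\<dots> \<le> indicator (cbox a b) x * \<bar>u x r - u x s\<bar>"
              using box_cutoff_le_1[of n a b x] cutoff_supp[of n a b x]
              by (intro mult_right_mono) (auto split: split_indicator)
            finally show "\<bar>box_cutoff n a b x * u x r - box_cutoff n a b x * u x s\<bar>
                \<le> 1 * (indicator (cbox a b) x * \<bar>u x r - u x s\<bar>)" by simp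
          qed
          then show ?thesis using r s by (subst Bochner_Integration.integral_diff[symmetric]) (auto intro: cut_int)
        qed
        then show "\<forall>\<^sub>F r in at s within {0..}. norm ((LINT x|lebesgue. box_cutoff n a b x * u x r)
            - (LINT x|lebesgue. box_cutoff n a b x * u x s)) \<le> (LINT x:cbox a b|lebesgue. \<bar>u x r - u x s\<bar>)"
          by (auto simp: eventually_at_filter)
      qed
    qed
  qed
  have integrand_cont: "continuous_on ({0..} \<times> cbox a b) (\<lambda>(s, x). box_cutoff n a b x * (exp s * L x s))" for n a b
  proof -
    have "continuous_on ({0..} \<times> cbox a b) (\<lambda>p. (\<lambda>(x, s). L x s) (snd p, fst p))"
      by (rule continuous_on_compose2[OF L_cont]) (auto intro!: continuous_intros)
    then have "continuous_on ({0..} \<times> cbox a b) (\<lambda>p. L (snd p) (fst p))" by simp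
    then have "continuous_on ({0..} \<times> cbox a b) (\<lambda>p. box_cutoff n a b (snd p) * (exp (fst p) * L (snd p) (fst p)))"
      by (intro continuous_intros continuous_on_compose2[OF cutoff_cont[of UNIV]]) auto
    then show ?thesis by (simp add: case_prod_beta)
  qed
  have W_cont: "continuous_on {0..} (W n a b)" for n a b
    unfolding W_def using integral_continuous_on_param[OF integrand_cont[of a b n]] .

  \<comment> \<open>The weak equation tested with \<open>\<chi>(x) \<psi>(t) e\<^sup>t\<close>, reduced by Fubini to one in time only.\<close>
  have weak_UW: "integral {c..d} (\<lambda>s. U n a b s * \<psi>' s) = - integral {c..d} (\<lambda>s. W n a b s * \<psi> s)"
    if cd: "0 < c" "c \<le> d" and \<psi>: "\<And>k. C_k k \<psi>" and \<psi>': "\<And>k. C_k k \<psi>'"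
      and d: "\<And>s. (\<psi> has_real_derivative \<psi>' s) (at s)" and supp: "\<And>s. s \<notin> {c..d} \<Longrightarrow> \<psi> s = 0"
    for n a b \<psi> \<psi>' c d
  proof -
    let ?\<chi> = "box_cutoff n a b"
    let ?K = "cbox a b \<times> {c..d}"
    have K: "compact ?K" "?K \<subseteq> spacetime" using cd by (auto intro: compact_Times)
    have cont: "continuous_on A \<psi>" "continuous_on A \<psi>'" for A
      using C_k_continuous[OF \<psi>[of 0]] C_k_continuous[OF \<psi>'[of 0]] by (auto intro: continuous_on_subset)
    have supp': "\<psi>' s = 0" if "s \<notin> {c..d}" for s
    proof -
      have "((\<lambda>_. 0) has_real_derivative \<psi>' s) (at s)"
        by (rule has_field_derivative_transform_within_open[OF d, of "- {c..d}"])
          (use that supp in \<open>auto intro: open_Compl\<close>)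
      then show ?thesis using DERIV_unique[of "\<lambda>_. 0" _ s 0] by auto
    qed
    define \<phi> where "\<phi> p = ?\<chi> (fst p) * (\<psi> (snd p) * exp (snd p))" for p
    have \<phi>_Ck: "C_k k \<phi>" for k
    proof -
      have "C_k k (\<lambda>p. ?\<chi> (fst p + 0) * (\<psi> (snd p + 0) * exp (snd p + 0)))"
        by (intro C_k_mult C_k_affine_compose[where l = fst] C_k_affine_compose[where l = snd]
            C_k_box_cutoff \<psi> C_k_exp bounded_linear_fst bounded_linear_snd)
      then show ?thesis by (simp add: \<phi>_def[abs_def])
    qed
    have \<phi>_supp: "tsupport \<phi> \<subseteq> ?K"
      unfolding tsupport_def
    proof (rule closure_minimal)
      show "{p. \<phi> p \<noteq> 0} \<subseteq> ?K"
      proof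
        fix p assume "p \<in> {p. \<phi> p \<noteq> 0}"
        then have "?\<chi> (fst p) \<noteq> 0" "\<psi> (snd p) \<noteq> 0" by (auto simp: \<phi>_def)
        then have "fst p \<in> cbox a b" "snd p \<in> {c..d}"
          using box_cutoff_eq_0[of "fst p" a b n] box_subset_cbox[of a b] supp[of "snd p"] by blast+
        then show "p \<in> ?K" by (auto simp: mem_Times_iff)
      qed
      show "closed ?K" using K(1) by (rule compact_imp_closed)
    qed
    have "compact (tsupport \<phi>)"
    proof -
      have "closed (tsupport \<phi>)" by (simp add: tsupport_def)
      with compact_Int_closed[OF K(1), of "tsupport \<phi>"] \<phi>_supp show ?thesis by (simp add: Int_absorb1)
    qed
    then have test: "test_function spacetime \<phi>"
      using \<phi>_Ck \<phi>_supp K(2) by (auto simp: test_function_def)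
    have D\<phi>: "frechet_derivative \<phi> (at p) (0, 1) = ?\<chi> (fst p) * ((\<psi>' (snd p) + \<psi> (snd p)) * exp (snd p))" for p
    proof -
      obtain x s where p: "p = (x, s)" by fastforce
      have "\<phi> differentiable (at (x, s))" using \<phi>_Ck[of "Suc 0"] by simp
      from frechet_time_derivative[OF this]
      have "((\<lambda>r. ?\<chi> x * (\<psi> r * exp r)) has_real_derivative frechet_derivative \<phi> (at (x, s)) (0, 1)) (at s)"
        by (simp add: \<phi>_def)
      moreover have "((\<lambda>r. ?\<chi> x * (\<psi> r * exp r)) has_real_derivative ?\<chi> x * ((\<psi>' s + \<psi> s) * exp s)) (at s)"
        by (auto intro!: derivative_eq_intros d simp: algebra_simps)
      ultimately show ?thesis unfolding p by (simp add: DERIV_unique)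
    qed
    \<comment> \<open>The time derivative of \<open>\<phi>\<close> is \<open>g1 + \<phi>\<close>; the summand \<open>\<phi>\<close> comes from the factor \<open>e\<^sup>t\<close> and cancels
      against the term \<open>- u\<close> of the equation.\<close>
    define g1 where "g1 p = ?\<chi> (fst p) * (\<psi>' (snd p) * exp (snd p))" for p
    have \<phi>_cont: "continuous_on UNIV \<phi>" using C_k_continuous[OF \<phi>_Ck[of 0]] .
    have g1_cont: "continuous_on UNIV g1"
      unfolding g1_def by (intro continuous_intros continuous_on_compose2[OF cutoff_cont[of UNIV]]
          continuous_on_compose2[OF cont(2)[of UNIV]]) auto
    let ?u = "\<lambda>(x, s). u x s" and ?L = "\<lambda>(x, s). L x s"
    have absK: "?u absolutely_integrable_on ?K" "w absolutely_integrable_on ?K" "?L absolutely_integrable_on ?K"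
      using weak convL K by (auto simp: weak_time_derivative_def locally_integrable_on_def L_def)
    note int = absolutely_integrable_times_continuous[OF _ K(1)]
    note i1 = int[OF absK(1) g1_cont] and i2 = int[OF absK(3) \<phi>_cont]
      and i3 = int[OF absK(1) \<phi>_cont] and i4 = int[OF absK(2) \<phi>_cont]
    have zero: "\<phi> p = 0" "g1 p = 0" if "p \<notin> ?K" for p
    proof -
      have "fst p \<notin> cbox a b \<or> snd p \<notin> {c..d}" using that by (auto simp: mem_Times_iff)
      then show "\<phi> p = 0" "g1 p = 0"
        using box_cutoff_eq_0[of "fst p" a b n] box_subset_cbox[of a b] supp[of "snd p"] supp'[of "snd p"]
        by (auto simp: \<phi>_def g1_def)
    qed
    have "(LINT p:spacetime|lebesgue. ?u p * frechet_derivative \<phi> (at p) (0, 1))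
        = - (LINT p:spacetime|lebesgue. w p * \<phi> p)"
      using weak test by (simp add: weak_time_derivative_def)
    moreover have "(LINT p:spacetime|lebesgue. ?u p * frechet_derivative \<phi> (at p) (0, 1))
        = (LINT p|lebesgue. indicator ?K p * (?u p * g1 p) + indicator ?K p * (?u p * \<phi> p))"
      unfolding set_lebesgue_integral_def
    proof (rule Bochner_Integration.integral_cong[OF refl])
      fix p :: "'a \<times> real"
      have "frechet_derivative \<phi> (at p) (0, 1) = g1 p + \<phi> p" by (simp add: D\<phi> g1_def \<phi>_def algebra_simps)
      then show "indicator spacetime p *\<^sub>R (?u p * frechet_derivative \<phi> (at p) (0, 1))
          = indicator ?K p * (?u p * g1 p) + indicator ?K p * (?u p * \<phi> p)"
        using K(2) zero[of p] by (cases "p \<in> ?K") (auto simp: distrib_left split: split_indicator)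
    qed
    moreover have "(LINT p:spacetime|lebesgue. w p * \<phi> p) = (LINT p|lebesgue. indicator ?K p * (w p * \<phi> p))"
      unfolding set_lebesgue_integral_def
    proof (rule Bochner_Integration.integral_cong[OF refl])
      fix p :: "'a \<times> real"
      show "indicator spacetime p *\<^sub>R (w p * \<phi> p) = indicator ?K p * (w p * \<phi> p)"
        using K(2) zero[of p] by (cases "p \<in> ?K") (auto split: split_indicator)
    qed
    moreover have "(LINT p|lebesgue. indicator ?K p * (w p * \<phi> p))
        = (LINT p|lebesgue. indicator ?K p * (?L p * \<phi> p) - indicator ?K p * (?u p * \<phi> p))"
    proof (rule integral_cong_AE)
      show "AE p in lebesgue. indicator ?K p * (w p * \<phi> p)
          = indicator ?K p * (?L p * \<phi> p) - indicator ?K p * (?u p * \<phi> p)"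
        using w_eq
      proof eventually_elim
        case (elim p)
        show ?case
        proof (cases "p \<in> ?K")
          case True
          then have "w p = ?L p - ?u p" using elim cd by (auto simp: L_def)
          show ?thesis unfolding \<open>w p = ?L p - ?u p\<close> left_diff_distrib right_diff_distrib ..
        qed simp
      qed
    qed (rule borel_measurable_integrable, intro i1 i2 i3 i4 Bochner_Integration.integrable_diff)+
    ultimately have key: "(LINT p|lebesgue. indicator ?K p * (?u p * g1 p))
        = - (LINT p|lebesgue. indicator ?K p * (?L p * \<phi> p))"
      using Bochner_Integration.integral_add[OF i1 i3] Bochner_Integration.integral_diff[OF i2 i3] by linarith
    have sub: "{c..d} \<subseteq> {0..}" using cd by auto
    have UW_cont: "continuous_on {c..d} (U n a b)" "continuous_on {c..d} (W n a b)"
      by (rule continuous_on_subset[OF U_cont sub] continuous_on_subset[OF W_cont sub])+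
    have slice: "(LINT p|lebesgue. f p) = integral {c..d} g"
      if "integrable lebesgue f" "continuous_on {c..d} g"
        and "\<And>s. s \<in> {c..d} \<Longrightarrow> (LINT x|lebesgue. f (x, s)) = g s"
        and "\<And>x s. s \<notin> {c..d} \<Longrightarrow> f (x, s) = 0" for f :: "'a \<times> real \<Rightarrow> real" and g
    proof -
      have "(LINT p|lebesgue. f p) = (LINT s|lborel. indicator {c..d} s *\<^sub>R g s)"
      proof (rule lebesgue_fubini[OF that(1)])
        show "(\<lambda>s. indicator {c..d} s *\<^sub>R g s) \<in> borel_measurable borel"
          using that(2) by (intro borel_measurable_continuous_on_indicator) auto
        show "(LINT x|lebesgue. f (x, s)) = indicator {c..d} s *\<^sub>R g s" for s
          using that(3,4) by (cases "s \<in> {c..d}") auto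
      qed
      also have "\<dots> = integral {c..d} g"
        using set_borel_integral_eq_integral(2)[OF borel_integrable_atLeastAtMost'[OF that(2)]]
        by (simp add: set_lebesgue_integral_def)
      finally show ?thesis .
    qed
    have "(LINT p|lebesgue. indicator ?K p * (?u p * g1 p)) = integral {c..d} (\<lambda>s. U n a b s * \<psi>' s)"
    proof (rule slice[OF i1])
      show "continuous_on {c..d} (\<lambda>s. U n a b s * \<psi>' s)" by (intro continuous_intros UW_cont cont)
      fix s assume s: "s \<in> {c..d}"
      have e: "indicator ?K (x, s) * (?u (x, s) * g1 (x, s)) = (exp s * \<psi>' s) * (?\<chi> x * u x s)" for x
        using s cutoff_supp[of n a b x] by (cases "x \<in> cbox a b") (auto simp: g1_def indicator_times)
      then show "(LINT x|lebesgue. indicator ?K (x, s) * (?u (x, s) * g1 (x, s))) = U n a b s * \<psi>' s"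
        unfolding e U_def by simp
    qed (auto simp: indicator_times)
    moreover have "(LINT p|lebesgue. indicator ?K p * (?L p * \<phi> p)) = integral {c..d} (\<lambda>s. W n a b s * \<psi> s)"
    proof (rule slice[OF i2])
      show "continuous_on {c..d} (\<lambda>s. W n a b s * \<psi> s)" by (intro continuous_intros UW_cont cont)
      fix s assume s: "s \<in> {c..d}"
      have "continuous_on (cbox a b) (\<lambda>x. (\<lambda>(s, x). ?\<chi> x * (exp s * L x s)) (s, x))"
        using s sub by (intro continuous_on_compose2[OF integrand_cont[of a b n]]) (auto intro!: continuous_intros)
      then have ci: "(\<lambda>x. ?\<chi> x * (exp s * L x s)) absolutely_integrable_on cbox a b"
        by (intro absolutely_integrable_continuous) simp
      have e: "indicator ?K (x, s) * (?L (x, s) * \<phi> (x, s))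
          = \<psi> s * (indicator (cbox a b) x *\<^sub>R (?\<chi> x * (exp s * L x s)))" for x
        using s by (auto simp: \<phi>_def indicator_times)
      then show "(LINT x|lebesgue. indicator ?K (x, s) * (?L (x, s) * \<phi> (x, s))) = W n a b s * \<psi> s"
        unfolding e W_def set_lebesgue_integral_eq_integral(2)[OF ci, symmetric] set_lebesgue_integral_def
        by simp
    qed (auto simp: indicator_times)
    ultimately show ?thesis using key by simp
  qed
  \<comment> \<open>The cutoff may now vary: the constant of integration is the pairing with \<open>u\<close> at time \<open>0\<close>.\<close>
  have UW: "U n a b t = U n a b 0 + integral {0..t} (W n a b)" for n a b
    by (rule weak_ode_imp_integral_eq[OF U_cont W_cont weak_UW t])

  define I where "I x = integral {0..t} (\<lambda>s. exp s * L x s)" for x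
  have I_cont: "continuous_on UNIV I"
    unfolding I_def
  proof -
    have "continuous_on (UNIV \<times> cbox 0 t) (\<lambda>(x, s). exp s * L x s)"
    proof -
      have "continuous_on (UNIV \<times> cbox 0 t) (\<lambda>p. (\<lambda>(x, s). L x s) p)"
        by (rule continuous_on_subset[OF L_cont]) auto
      then show ?thesis unfolding case_prod_beta by (intro continuous_intros)
    qed
    from integral_continuous_on_param[OF this]
    show "continuous_on UNIV (\<lambda>x. integral {0..t} (\<lambda>s. exp s * L x s))" by (simp add: box_real)
  qed
  have F0: "AE x in lebesgue. exp t * u x t - u x 0 - I x = 0"
  proof (rule AE_zero_of_test_integrals_zero)
    show "locally_integrable_on (\<lambda>x. exp t * u x t - u x 0 - I x) UNIV"
      using loc[OF t] loc[OF order_refl] continuous_imp_locally_integrable[OF I_cont]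
      by (auto simp: locally_integrable_on_def intro!: set_integral_diff)
    fix n and a b :: 'a
    have Ii: "integrable lebesgue (\<lambda>x. box_cutoff n a b x * I x)"
      using absolutely_integrable_times_continuous[OF _ compact_cbox cutoff_cont[where n = n and a = a and b = b], where f = I]
        continuous_imp_locally_integrable[OF I_cont]
      by (subst cutoff_supp) (simp add: ac_simps locally_integrable_on_def)
    have ci: "(\<lambda>x. box_cutoff n a b x * I x) absolutely_integrable_on cbox a b"
      by (intro absolutely_integrable_continuous continuous_intros cutoff_cont continuous_on_subset[OF I_cont]) auto
    have "(LINT x|lebesgue. box_cutoff n a b x * I x) = integral (cbox a b) (\<lambda>x. box_cutoff n a b x * I x)"
      unfolding set_lebesgue_integral_eq_integral(2)[OF ci, symmetric] set_lebesgue_integral_def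
      by (subst cutoff_supp) (simp add: ac_simps)
    also have "\<dots> = integral (cbox a b) (\<lambda>x. integral (cbox 0 t) (\<lambda>s. box_cutoff n a b x * (exp s * L x s)))"
      by (simp add: I_def box_real)
    also have "\<dots> = integral (cbox 0 t) (\<lambda>s. integral (cbox a b) (\<lambda>x. box_cutoff n a b x * (exp s * L x s)))"
    proof (rule integral_swap_continuous)
      have "continuous_on (cbox (a, 0) (b, t)) (\<lambda>p. (\<lambda>(s, x). box_cutoff n a b x * (exp s * L x s)) (snd p, fst p))"
        by (rule continuous_on_compose2[OF integrand_cont[of a b n]])
           (auto intro!: continuous_intros simp: cbox_Pair_eq)
      then show "continuous_on (cbox (a, 0) (b, t)) (\<lambda>(x, s). box_cutoff n a b x * (exp s * L x s))"
        by (simp add: case_prod_beta)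
    qed
    also have "\<dots> = integral {0..t} (W n a b)" by (simp add: W_def[abs_def] box_real)
    finally have I_W: "(LINT x|lebesgue. box_cutoff n a b x * I x) = integral {0..t} (W n a b)" .
    have "(LINT x|lebesgue. box_cutoff n a b x * (exp t * u x t - u x 0 - I x))
      = (LINT x|lebesgue. exp t * (box_cutoff n a b x * u x t) - box_cutoff n a b x * u x 0 - box_cutoff n a b x * I x)"
      by (simp add: algebra_simps)
    also have "\<dots> = U n a b t - U n a b 0 - integral {0..t} (W n a b)"
      using cut_int[OF t, of n a b] cut_int[OF order_refl, of n a b] Ii I_W by (simp add: U_def)
    also have "\<dots> = 0" using UW by simp
    finally show "(LINT x|lebesgue. box_cutoff n a b x * (exp t * u x t - u x 0 - I x)) = 0" .
  qed
  show ?thesis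
    using F0 init by eventually_elim (simp add: I_def L_def)
qed

end

section \<open>The factorial against the critical growth\<close>

text \<open>
  A majorant of \<open>growth\<close> as a function of the radius.  The shift by \<open>1\<close> makes it monotone on all of
  \<open>[0, \<infinity>)\<close>, whereas \<open>r ln r\<close> decreases near \<open>0\<close>; it keeps the leading asymptotics.
\<close>

definition growth_bound :: "real \<Rightarrow> real \<Rightarrow> real" where
  "growth_bound \<alpha> r = exp (\<alpha> * ((r + 1) * ln (r + 1)))"

lemma growth_bound_pos: "0 < growth_bound \<alpha> r" by (simp add: growth_bound_def)

lemma growth_bound_mono:
  assumes "0 \<le> \<alpha>" "0 \<le> r" "r \<le> s"
  shows "growth_bound \<alpha> r \<le> growth_bound \<alpha> s"
proof -
  have "(r + 1) * ln (r + 1) \<le> (s + 1) * ln (s + 1)"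
    using assms by (intro mult_mono) auto
  then show ?thesis using assms by (auto simp: growth_bound_def intro!: mult_left_mono)
qed

lemma growth_le_growth_bound:
  assumes "0 \<le> \<alpha>"
  shows "growth \<alpha> x \<le> growth_bound \<alpha> (norm x)"
proof -
  have "norm x * ln (norm x) \<le> (norm x + 1) * ln (norm x + 1)"
  proof (cases "norm x = 0")
    case False
    then have pos: "0 < norm x" by simp
    then have "ln (norm x) \<le> ln (norm x + 1)" by (subst ln_le_cancel_iff) linarith+
    then have "norm x * ln (norm x) \<le> norm x * ln (norm x + 1)" by (intro mult_left_mono) auto
    also have "\<dots> \<le> (norm x + 1) * ln (norm x + 1)" by (intro mult_right_mono) auto
    finally show ?thesis .
  qed simp
  then have "\<alpha> * (norm x * ln (norm x)) \<le> \<alpha> * ((norm x + 1) * ln (norm x + 1))"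
    using assms by (rule mult_left_mono)
  then show ?thesis by (simp add: growth_def growth_bound_def mult.assoc)
qed

text \<open>
  The half \<open>k\<^sup>k / k! \<le> e\<^sup>k\<close> of Stirling's formula, from a single term of the exponential series.
\<close>

lemma ln_fact_ge: "real k * ln (real k) - real k \<le> ln (fact k)"
proof (cases "k = 0")
  case False
  have "(real k) ^ k / fact k \<le> exp (real k)"
  proof -
    have "(real k) ^ k / fact k = (\<Sum>i\<in>{k}. (real k) ^ i /\<^sub>R fact i)" by (simp add: field_simps)
    also have "\<dots> \<le> (\<Sum>i. (real k) ^ i /\<^sub>R fact i)"
      by (intro sum_le_suminf summable_exp_generic) auto
    finally show ?thesis by (simp add: exp_def)
  qed
  then have "(real k) ^ k \<le> exp (real k) * fact k" by (simp add: field_simps)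
  then have "ln ((real k) ^ k) \<le> ln (exp (real k) * fact k)" using False by simp
  also have "\<dots> = real k + ln (fact k)" by (simp add: ln_mult)
  finally show ?thesis using False by (simp add: ln_realpow)
qed simp

text \<open>
  On the logarithmic scale the leading terms are \<open>- k ln k\<close> from the factorial and \<open>\<alpha> k ln k\<close> from
  the growth; all others are of lower order.
\<close>

lemma growth_series_tendsto_0:
  assumes \<alpha>: "0 < \<alpha>" "\<alpha> < 1" and r: "0 \<le> r" and t: "0 < t"
  shows "(\<lambda>k. t ^ k / fact k * growth_bound \<alpha> (r + real k)) \<longlonglongrightarrow> 0"
proof (rule Lim_null_comparison[where g = "\<lambda>k. exp (real k * ln t - (real k * ln (real k) - real k)
      + \<alpha> * ((r + real k + 1) * ln (r + real k + 1)))"])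
  show "\<forall>\<^sub>F k in sequentially. norm (t ^ k / fact k * growth_bound \<alpha> (r + real k))
     \<le> exp (real k * ln t - (real k * ln (real k) - real k) + \<alpha> * ((r + real k + 1) * ln (r + real k + 1)))"
  proof (intro always_eventually allI)
    fix k
    have "t ^ k / fact k = exp (real k * ln t - ln (fact k))"
      using t by (simp add: exp_diff exp_of_nat_mult)
    then have "norm (t ^ k / fact k * growth_bound \<alpha> (r + real k))
      = exp (real k * ln t - ln (fact k) + \<alpha> * ((r + real k + 1) * ln (r + real k + 1)))"
      by (simp add: growth_bound_def exp_add)
    also have "\<dots> \<le> exp (real k * ln t - (real k * ln (real k) - real k) + \<alpha> * ((r + real k + 1) * ln (r + real k + 1)))"
      using ln_fact_ge[of k] by simp
    finally show "norm (t ^ k / fact k * growth_bound \<alpha> (r + real k))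
     \<le> exp (real k * ln t - (real k * ln (real k) - real k) + \<alpha> * ((r + real k + 1) * ln (r + real k + 1)))" .
  qed
  show "(\<lambda>k. exp (real k * ln t - (real k * ln (real k) - real k)
      + \<alpha> * ((r + real k + 1) * ln (r + real k + 1)))) \<longlonglongrightarrow> 0"
    using \<alpha> by real_asymp
qed

text \<open>
  The terms for a time more than twice as large tend to \<open>0\<close>, in particular they are bounded; going back
  to the time \<open>t\<close> gains the summable factor \<open>2\<^bsup>-k\<^esup>\<close>.
\<close>

lemma growth_series_summable:
  assumes \<alpha>: "0 < \<alpha>" "\<alpha> < 1" and r: "0 \<le> r" and t: "0 \<le> t"
  shows "summable (\<lambda>k. t ^ k / fact k * growth_bound \<alpha> (r + real k))"
proof -
  have "(\<lambda>k. (2 * (t + 1)) ^ k / fact k * growth_bound \<alpha> (r + real k)) \<longlonglongrightarrow> 0"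
    using assms by (intro growth_series_tendsto_0) auto
  then have "Bseq (\<lambda>k. (2 * (t + 1)) ^ k / fact k * growth_bound \<alpha> (r + real k))"
    by (intro convergent_imp_Bseq) (auto simp: convergent_def)
  then obtain M where M: "\<And>k. norm ((2 * (t + 1)) ^ k / fact k * growth_bound \<alpha> (r + real k)) \<le> M"
    by (auto simp: Bseq_def)
  have "norm (t ^ k / fact k * growth_bound \<alpha> (r + real k)) \<le> M * (1 / 2) ^ k" for k
  proof -
    have "norm (t ^ k / fact k * growth_bound \<alpha> (r + real k))
        \<le> (t + 1) ^ k / fact k * growth_bound \<alpha> (r + real k)"
      using t growth_bound_pos[of \<alpha> "r + real k"]
      by (auto simp: abs_mult intro!: mult_right_mono divide_right_mono power_mono)
    also have "\<dots> = (2 * (t + 1)) ^ k / fact k * growth_bound \<alpha> (r + real k) * (1 / 2) ^ k"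
      unfolding power_mult_distrib by (simp add: power_divide)
    also have "\<dots> \<le> M * (1 / 2) ^ k"
    proof (rule mult_right_mono)
      show "(2 * (t + 1)) ^ k / fact k * growth_bound \<alpha> (r + real k) \<le> M"
        using M[of k] unfolding real_norm_def by linarith
    qed simp
    finally show ?thesis .
  qed
  moreover have "summable (\<lambda>k. M * (1 / 2 :: real) ^ k)"
    by (rule summable_mult) simp
  ultimately show ?thesis by (rule summable_comparison_test'[rotated, where N = 0])
qed

text \<open>
  Here \<open>\<gamma>\<close> is the effective exponent: the argument grows like \<open>c k\<close> only, so the coefficient
  \<open>\<gamma> / c\<close> in the exponent contributes \<open>\<gamma> k ln k\<close>, which beats \<open>ln k! \<le> k ln k\<close>.
\<close>

lemma supercritical_series_unbounded:
  assumes \<gamma>: "1 < \<gamma>" and c: "0 < c" "c < 1" and \<eta>: "0 < \<eta>"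
  shows "filterlim (\<lambda>k. \<eta> ^ k / fact k * exp (\<gamma> / c * ((1 + c * real k) * ln (1 + c * real k)))) at_top sequentially"
proof (rule filterlim_at_top_mono)
  show "filterlim (\<lambda>k. exp (real k * ln \<eta> - real k * ln (real k)
      + \<gamma> / c * ((1 + c * real k) * ln (1 + c * real k)))) at_top sequentially"
    using assms by real_asymp
  show "\<forall>\<^sub>F k in sequentially. exp (real k * ln \<eta> - real k * ln (real k)
      + \<gamma> / c * ((1 + c * real k) * ln (1 + c * real k)))
    \<le> \<eta> ^ k / fact k * exp (\<gamma> / c * ((1 + c * real k) * ln (1 + c * real k)))"
    using eventually_gt_at_top[of 0]
  proof eventually_elim
    case (elim k)
    have "(fact k :: real) \<le> real (k ^ k)" by (rule fact_le_power)
    then have "ln (fact k) \<le> ln (real k ^ k)"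
      using elim by (subst ln_le_cancel_iff) auto
    then have "ln (fact k) \<le> real k * ln (real k)" using elim by (simp add: ln_realpow)
    moreover have "\<eta> ^ k / fact k = exp (real k * ln \<eta> - ln (fact k))"
      using \<eta> by (simp add: exp_diff exp_of_nat_mult)
    ultimately show ?case by (simp add: exp_add[symmetric])
  qed
qed

lemma has_integral_power_div_fact:
  assumes "0 \<le> t"
  shows "((\<lambda>s. s ^ k / fact k) has_integral (t ^ Suc k / fact (Suc k) :: real)) {0..t}"
proof -
  have "((\<lambda>s. s ^ k / fact k) has_integral (t ^ Suc k / fact (Suc k) - 0 ^ Suc k / fact (Suc k) :: real)) {0..t}"
  proof (rule fundamental_theorem_of_calculus[OF assms])
    fix s :: real
    have "((\<lambda>s. s ^ Suc k / fact (Suc k)) has_real_derivative (real (Suc k) * s ^ k) / fact (Suc k)) (at s within {0..t})"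
      by (rule DERIV_cdivide) (use DERIV_pow[of "Suc k" s "{0..t}"] in simp)
    moreover have "(real (Suc k) * s ^ k) / fact (Suc k) = s ^ k / fact k"
      unfolding fact_Suc of_nat_mult by (rule mult_divide_mult_cancel_left) simp
    ultimately show "((\<lambda>s. s ^ Suc k / fact (Suc k)) has_vector_derivative s ^ k / fact k) (at s within {0..t})"
      by (simp only: has_real_derivative_iff_has_vector_derivative[symmetric])
  qed
  then show ?thesis by simp
qed


section \<open>Uniqueness in the subcritical class\<close>

context dispersal_kernel
begin

text \<open>
  The difference \<open>z\<close> of the two solutions, multiplied by \<open>e\<^sup>t\<close>, satisfies \<open>z(t) = \<integral>\<^sub>0\<^sup>t J \<star> z\<close>.  Feeding the
  growth bound into this identity \<open>k\<close> times produces the factor \<open>t\<^sup>k / k!\<close> at the price of replacing the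
  radius \<open>|x|\<close> by \<open>|x| + k\<close>, and the result tends to \<open>0\<close> as \<open>k\<close> grows.
\<close>

lemma solution_unique:
  assumes \<alpha>: "0 < \<alpha>" "\<alpha> < 1"
    and u: "strong_solution J u0 u" and Cu: "locally_bounded_on Cu {0..}"
      "\<And>t. 0 \<le> t \<Longrightarrow> AE x in lebesgue. \<bar>u x t\<bar> \<le> Cu t * growth \<alpha> x"
    and v: "strong_solution J u0 v" and Cv: "locally_bounded_on Cv {0..}"
      "\<And>t. 0 \<le> t \<Longrightarrow> AE x in lebesgue. \<bar>v x t\<bar> \<le> Cv t * growth \<alpha> x"
    and T: "0 \<le> T"
  shows "AE x in lebesgue. u x T = v x T"
proof -
  define z where "z x t = exp t * (u x t - v x t)" for x t
  have L1: "continuous_L1loc u" "continuous_L1loc v" using u v by (auto simp: strong_solution_def)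
  have loc: "locally_integrable_on (\<lambda>x. u x t) UNIV" "locally_integrable_on (\<lambda>x. v x t) UNIV" if "0 \<le> t" for t
    using L1 that by (auto simp: continuous_L1loc_def)
  have z_loc: "locally_integrable_on (\<lambda>x. z x t) UNIV" if "0 \<le> t" for t
    using loc[OF that] by (auto simp: z_def locally_integrable_on_def intro!: set_integral_diff)
  define Z where "Z x t = space_conv J (\<lambda>y. z y t) x" for x t
  have Z_eq: "Z x t = exp t * space_conv J (\<lambda>y. u y t) x - exp t * space_conv J (\<lambda>y. v y t) x" if "0 \<le> t" for x t
  proof -
    have "Z x t = exp t * space_conv J (\<lambda>y. u y t - v y t) x" unfolding Z_def z_def by (rule conv_scale)
    also have "space_conv J (\<lambda>y. u y t - v y t) x = space_conv J (\<lambda>y. u y t) x - space_conv J (\<lambda>y. v y t) x"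
      unfolding space_conv_def right_diff_distrib
      by (intro Bochner_Integration.integral_diff conv_integrable loc that)
    finally show ?thesis by (simp add: right_diff_distrib)
  qed
  have Z_int: "Z x integrable_on {0..t}" if "0 \<le> t" for x t
  proof (rule integrable_continuous_real)
    have "continuous_on {0..t} (\<lambda>t. exp t * space_conv J (\<lambda>y. u y t) x - exp t * space_conv J (\<lambda>y. v y t) x)"
      by (intro continuous_on_diff continuous_on_subset[OF conv_continuous_time] L1) auto
    then show "continuous_on {0..t} (Z x)" by (rule continuous_on_eq) (simp add: Z_eq)
  qed
  have z_eq: "AE x in lebesgue. z x t = integral {0..t} (Z x)" if t: "0 \<le> t" for t
    using solution_integral_eq[OF u t] solution_integral_eq[OF v t]
  proof eventually_elim
    case (elim x)
    have "integral {0..t} (Z x) = integral {0..t} (\<lambda>t. exp t * space_conv J (\<lambda>y. u y t) x - exp t * space_conv J (\<lambda>y. v y t) x)"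
      by (rule Henstock_Kurzweil_Integration.integral_cong) (simp add: Z_eq)
    also have "\<dots> = integral {0..t} (\<lambda>t. exp t * space_conv J (\<lambda>y. u y t) x) - integral {0..t} (\<lambda>t. exp t * space_conv J (\<lambda>y. v y t) x)"
      by (intro Henstock_Kurzweil_Integration.integral_diff integrable_continuous_real
          continuous_on_subset[OF conv_continuous_time] L1) auto
    finally show ?case using elim by (simp add: z_def algebra_simps)
  qed
  have "bounded (Cu ` {0..T})" "bounded (Cv ` {0..T})"
    using Cu(1) Cv(1) by (auto simp: locally_bounded_on_def)
  then obtain bu bv where "\<forall>t\<in>{0..T}. \<bar>Cu t\<bar> \<le> bu" "\<forall>t\<in>{0..T}. \<bar>Cv t\<bar> \<le> bv"
    unfolding bounded_iff by auto
  then have b: "\<bar>Cu t\<bar> \<le> bu" "\<bar>Cv t\<bar> \<le> bv" if "t \<in> {0..T}" for t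
    using that by blast+
  define M where "M = exp T * (bu + bv)"
  have M: "0 \<le> M" using b[of 0] T by (auto simp: M_def)
  \<comment> \<open>The starting bound uses that \<open>Cu\<close> and \<open>Cv\<close> are bounded on \<open>[0, T]\<close>; the constant \<open>M\<close> then stays the
    same throughout the iteration.\<close>
  have bound: "AE x in lebesgue. \<bar>z x t\<bar> \<le> M * (t ^ k / fact k) * growth_bound \<alpha> (norm x + real k)"
    if "t \<in> {0..T}" for t k
    using that
  proof (induction k arbitrary: t)
    case 0
    then have "0 \<le> t" by simp
    from Cu(2)[OF this] Cv(2)[OF this] show ?case
    proof eventually_elim
      case (elim x)
      have g: "0 < growth \<alpha> x" by (simp add: growth_def)
      have "Cu t * growth \<alpha> x \<le> bu * growth \<alpha> x" "Cv t * growth \<alpha> x \<le> bv * growth \<alpha> x"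
        using b[OF 0] g by (auto intro!: mult_right_mono)
      then have "\<bar>u x t - v x t\<bar> \<le> (bu + bv) * growth \<alpha> x" using elim by (simp add: distrib_right)
      also have "\<dots> \<le> (bu + bv) * growth_bound \<alpha> (norm x)"
        using \<alpha> b[OF 0] by (intro mult_left_mono growth_le_growth_bound) auto
      finally have "exp t * \<bar>u x t - v x t\<bar> \<le> exp T * ((bu + bv) * growth_bound \<alpha> (norm x))"
        using 0 by (intro mult_mono) auto
      then show ?case by (simp add: z_def M_def abs_mult mult.assoc)
    qed
  next
    case (Suc k)
    then have t: "0 \<le> t" by simp
    have Zb: "\<bar>Z x s\<bar> \<le> M * growth_bound \<alpha> (norm x + real (Suc k)) * (s ^ k / fact k)" if s: "s \<in> {0..t}" for x s
      unfolding Z_def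
    proof (rule conv_abs_le[OF z_loc])
      show "AE y in lebesgue. norm y \<le> norm x + 1 \<longrightarrow> \<bar>z y s\<bar> \<le> M * growth_bound \<alpha> (norm x + real (Suc k)) * (s ^ k / fact k)"
        using Suc.IH[of s] s Suc.prems
      proof (simp del: fact_Suc, elim AE_mp, intro AE_I2 impI)
        fix y assume 1: "\<bar>z y s\<bar> \<le> M * s ^ k * growth_bound \<alpha> (norm y + real k) / fact k" and y: "norm y \<le> norm x + 1"
        have "growth_bound \<alpha> (norm y + real k) \<le> growth_bound \<alpha> (norm x + (1 + real k))"
          using \<alpha> y by (intro growth_bound_mono) auto
        then have "M * s ^ k / fact k * growth_bound \<alpha> (norm y + real k) \<le> M * s ^ k / fact k * growth_bound \<alpha> (norm x + (1 + real k))"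
          using M s by (intro mult_left_mono) auto
        then show "\<bar>z y s\<bar> \<le> M * growth_bound \<alpha> (norm x + (1 + real k)) * s ^ k / fact k"
          using 1 by (simp add: ac_simps)
      qed
    qed (use s in auto)
    have hi: "((\<lambda>s. M * growth_bound \<alpha> (norm x + real (Suc k)) * (s ^ k / fact k)) has_integral
        M * growth_bound \<alpha> (norm x + real (Suc k)) * (t ^ Suc k / fact (Suc k))) {0..t}" for x
      by (intro has_integral_mult_right has_integral_power_div_fact t)
    from z_eq[OF t] show ?case
    proof eventually_elim
      case (elim x)
      have "norm (integral {0..t} (Z x)) \<le> integral {0..t} (\<lambda>s. M * growth_bound \<alpha> (norm x + real (Suc k)) * (s ^ k / fact k))"
        using Zb by (intro integral_norm_bound_integral Z_int t has_integral_integrable[OF hi]) auto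
      also have "\<dots> = M * growth_bound \<alpha> (norm x + real (Suc k)) * (t ^ Suc k / fact (Suc k))"
        by (rule integral_unique[OF hi])
      finally show ?case unfolding elim by (simp add: ac_simps del: fact_Suc)
    qed
  qed
  have "AE x in lebesgue. \<forall>k. \<bar>z x T\<bar> \<le> M * (T ^ k / fact k) * growth_bound \<alpha> (norm x + real k)"
    unfolding AE_all_countable using bound[of T] T by simp
  then show ?thesis
  proof eventually_elim
    case (elim x)
    have "(\<lambda>k. M * (T ^ k / fact k * growth_bound \<alpha> (norm x + real k))) \<longlonglongrightarrow> M * 0"
      by (intro tendsto_mult tendsto_const summable_LIMSEQ_zero growth_series_summable \<alpha> T) auto
    then have "\<bar>z x T\<bar> \<le> M * 0"
      using elim by (intro LIMSEQ_le_const[of _ "M * 0" "\<bar>z x T\<bar>"]) (auto simp: mult.assoc)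
    then show ?case by (simp add: z_def)
  qed
qed


section \<open>Blow-up for supercritical data\<close>

text \<open>
  The vector \<open>e\<close> is a limit of points with \<open>J > 0\<close>, so one of them has \<open>z \<bullet> e > c\<close>; if the integral vanished,
  \<open>J\<close> would be zero almost everywhere, hence by continuity everywhere, on the open half-space
  \<open>z \<bullet> e > c\<close>.
\<close>

lemma kernel_mass_near_boundary:
  assumes full: "tsupport J = cball 0 1" and e: "norm e = 1" and c: "c < 1"
  shows "0 < (LINT z|lebesgue. J z * indicator {z. c \<le> z \<bullet> e} z)"
proof -
  let ?S = "{z. c \<le> z \<bullet> e}"
  have S: "?S \<in> sets borel" by measurable
  have J: "integrable lebesgue J" using kernel_mass by (simp add: has_bochner_integral_iff)
  have i: "integrable lebesgue (\<lambda>z. J z * indicator ?S z)"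
    using S by (intro integrable_real_mult_indicator J) auto
  have nn: "0 \<le> J z * indicator ?S z" for z using kernel_nonneg by simp
  have "(LINT z|lebesgue. J z * indicator ?S z) \<noteq> 0"
  proof
    assume "(LINT z|lebesgue. J z * indicator ?S z) = 0"
    then have "AE z in lebesgue. J z * indicator ?S z = 0"
      using integral_nonneg_eq_0_iff_AE[OF i] nn by simp
    then have "AE z in lebesgue. z \<in> {z. J z = 0} \<union> {z. z \<bullet> e \<le> c}"
      by eventually_elim (auto split: split_indicator_asm)
    moreover have "closed ({z. J z = 0} \<union> {z. z \<bullet> e \<le> c})"
      using kernel_cont by (intro closed_Un closed_Collect_eq closed_Collect_le continuous_intros)
    ultimately have all: "z \<in> {z. J z = 0} \<union> {z. z \<bullet> e \<le> c}" for z
      by (rule mem_closed_if_AE_lebesgue[rotated])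
    have "e \<in> closure {z. J z \<noteq> 0}" using full e by (simp add: tsupport_def)
    then have "\<exists>z\<in>{z. J z \<noteq> 0}. dist z e < 1 - c"
      using c unfolding closure_approachable by simp
    then obtain z where z: "J z \<noteq> 0" "dist z e < 1 - c" by blast
    have "\<bar>(z - e) \<bullet> e\<bar> \<le> norm (z - e) * norm e" by (rule Cauchy_Schwarz_ineq2)
    then have "\<bar>z \<bullet> e - 1\<bar> < 1 - c" using z e by (simp add: inner_diff_left dist_norm norm_eq_1)
    then have "c < z \<bullet> e" by linarith
    with all[of z] z show False by simp
  qed
  moreover have "0 \<le> (LINT z|lebesgue. J z * indicator ?S z)" using nn by (intro integral_nonneg_AE) auto
  ultimately show ?thesis by linarith
qed

text \<open>
  Restricting every convolution to increments with \<open>z \<bullet> e \<ge> c\<close> keeps the mass \<open>\<eta>\<close> and pushes the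
  argument by \<open>c\<close> in direction \<open>e\<close>.  Comparing with \<open>g(x \<bullet> e)\<close> instead of \<open>g(|x|)\<close>, on the half-space
  \<open>x \<bullet> e \<ge> 1\<close> that these increments preserve and on which \<open>g\<close> is increasing, makes the lower bound
  reproduce itself under \<open>v \<mapsto> \<integral>\<^sub>0\<^sup>t J \<star> v\<close>; iterated kernels never have to be estimated.
\<close>

lemma no_nonneg_solution:
  assumes full: "tsupport J = cball 0 1" and c0: "0 < c0" and \<beta>: "1 < \<beta>"
    and u0: "\<And>x. c0 * growth \<beta> x \<le> u0 x"
    and u: "strong_solution J u0 u" and nonneg: "\<And>t. 0 \<le> t \<Longrightarrow> AE x in lebesgue. 0 \<le> u x t"
  shows False
proof -
  obtain e :: 'a where "e \<in> Basis" using nonempty_Basis by blast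
  then have e: "norm e = 1" by simp
  \<comment> \<open>The midpoint of \<open>1 / \<beta>\<close> and \<open>1\<close>, so that both \<open>c < 1\<close> and \<open>\<beta> * c > 1\<close>.\<close>
  define c where "c = (1 + 1 / \<beta>) / 2"
  have c: "0 < c" "c < 1" "1 < \<beta> * c" using \<beta> by (auto simp: c_def field_simps)
  define \<eta> where "\<eta> = (LINT z|lebesgue. J z * indicator {z. c \<le> z \<bullet> e} z)"
  have \<eta>: "0 < \<eta>" unfolding \<eta>_def by (rule kernel_mass_near_boundary[OF full e c(2)])
  define g where "g s = exp (\<beta> * (s * ln s))" for s :: real
  have g_pos: "0 < g s" for s by (simp add: g_def)
  have g_mono: "g r \<le> g s" if "1 \<le> r" "r \<le> s" for r s
    using that \<beta> by (auto simp: g_def intro!: mult_left_mono mult_mono)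
  have L1: "continuous_L1loc u" using u by (simp add: strong_solution_def)
  define v where "v x t = exp t * u x t" for x t
  define Z where "Z x s = space_conv J (\<lambda>y. v y s) x" for x s
  have Z_eq: "Z x s = exp s * space_conv J (\<lambda>y. u y s) x" for x s unfolding Z_def v_def by (rule conv_scale)
  have Z_int: "Z x integrable_on {0..t}" for x t
    unfolding Z_eq[abs_def] by (intro integrable_continuous_real continuous_on_subset[OF conv_continuous_time[OF L1]]) auto
  have v_eq: "AE x in lebesgue. v x t = u0 x + integral {0..t} (Z x)" if "0 \<le> t" for t
    using solution_integral_eq[OF u that] by (simp add: v_def Z_eq[abs_def])
  have v_nonneg: "AE x in lebesgue. 0 \<le> v x t" if "0 \<le> t" for t
    using nonneg[OF that] by (simp add: v_def zero_le_mult_iff)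
  have v_conv: "integrable lebesgue (\<lambda>y. J (x - y) * v y s)" if "0 \<le> s" for x s
    using L1 that by (intro conv_integrable) (auto simp: v_def continuous_L1loc_def locally_integrable_on_def)
  have Z_nonneg: "0 \<le> Z x s" if "0 \<le> s" for x s
    unfolding Z_def space_conv_def
    using v_nonneg[OF that] by (intro integral_nonneg_AE) (auto simp: kernel_nonneg)
  have u0_nonneg: "0 \<le> u0 x" for x
    using u0[of x] c0 by (smt (verit) exp_gt_zero growth_def mult_nonneg_nonneg)
  \<comment> \<open>Lower bounds by the single terms already force \<open>v\<close> to be infinite as \<open>k\<close> grows.\<close>
  have lower: "AE x in lebesgue. 1 \<le> x \<bullet> e \<longrightarrow> c0 * ((\<eta> * t) ^ k / fact k) * g (x \<bullet> e + c * real k) \<le> v x t"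
    if "0 \<le> t" for t k
    using that
  proof (induction k arbitrary: t)
    case 0
    from v_eq[OF 0] show ?case
    proof (eventually_elim, intro impI)
      fix x assume eq: "v x t = u0 x + integral {0..t} (Z x)" and x: "1 \<le> x \<bullet> e"
      have "x \<bullet> e \<le> norm x" using norm_cauchy_schwarz[of x e] e by simp
      then have "g (x \<bullet> e) \<le> growth \<beta> x" using g_mono[OF x] by (simp add: g_def growth_def mult.assoc)
      then have "c0 * g (x \<bullet> e) \<le> u0 x" using u0[of x] c0 by (meson mult_left_mono less_imp_le order_trans)
      moreover have "0 \<le> integral {0..t} (Z x)"
        using Z_nonneg by (intro Henstock_Kurzweil_Integration.integral_nonneg Z_int) auto
      ultimately show "c0 * ((\<eta> * t) ^ 0 / fact 0) * g (x \<bullet> e + c * real 0) \<le> v x t" by (simp add: eq)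
    qed
  next
    case (Suc k)
    have Zb: "(c0 * \<eta> ^ Suc k * g (x \<bullet> e + c * real (Suc k))) * (s ^ k / fact k) \<le> Z x s"
      if x: "1 \<le> x \<bullet> e" and s: "0 \<le> s" for x s
    proof -
      \<comment> \<open>The lower bound for \<open>v\<close> at time \<open>s\<close>, valid at every point reached from \<open>x\<close> by an increment
        with \<open>z \<bullet> e \<ge> c\<close>.\<close>
      define D where "D = c0 * ((\<eta> * s) ^ k / fact k) * g (x \<bullet> e + c * real (Suc k))"
      have D: "0 \<le> D" unfolding D_def using c0 \<eta> s g_pos by (auto simp: less_imp_le)
      have S: "{z. c \<le> z \<bullet> e} \<in> sets borel" by measurable
      have "D * \<eta> = (LINT z|lebesgue. J z * (indicator {z. c \<le> z \<bullet> e} z * D))"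
        unfolding \<eta>_def mult.assoc[symmetric] by simp
      also have "\<dots> = (LINT y|lebesgue. J (x - y) * (indicator {z. c \<le> z \<bullet> e} (y - x) * D))"
        using S by (intro kernel_shift_integral[of "\<lambda>z. indicator {z. c \<le> z \<bullet> e} z * D" x, symmetric]) auto
      also have "\<dots> \<le> Z x s"
        unfolding Z_def space_conv_def
      proof (rule integral_mono_AE)
        show "integrable lebesgue (\<lambda>y. J (x - y) * v y s)" by (rule v_conv[OF s])
        have "(\<lambda>y. indicator {z. c \<le> z \<bullet> e} (y - x)) \<in> borel_measurable lborel" by measurable
        then have m: "(\<lambda>y. indicator {z. c \<le> z \<bullet> e} (y - x) * D) \<in> borel_measurable lebesgue"
          by (intro measurable_completion) auto
        show "integrable lebesgue (\<lambda>y. J (x - y) * (indicator {z. c \<le> z \<bullet> e} (y - x) * D))"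
        proof (rule Bochner_Integration.integrable_bound)
          show "integrable lebesgue (\<lambda>y. J (x - y) * D)" using kernel_shift_integrable by auto
          show "(\<lambda>y. J (x - y) * (indicator {z. c \<le> z \<bullet> e} (y - x) * D)) \<in> borel_measurable lebesgue"
            by (rule borel_measurable_times[OF borel_measurable_integrable[OF kernel_shift_integrable] m])
        qed (auto split: split_indicator)
        show "AE y in lebesgue. J (x - y) * (indicator {z. c \<le> z \<bullet> e} (y - x) * D) \<le> J (x - y) * v y s"
          using Suc.IH[OF s] v_nonneg[OF s]
        proof eventually_elim
          case (elim y)
          have "indicator {z. c \<le> z \<bullet> e} (y - x) * D \<le> v y s"
          proof (cases "c \<le> (y - x) \<bullet> e")
            case True
            then have y: "x \<bullet> e + c \<le> y \<bullet> e" by (simp add: inner_diff_left)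
            have "D \<le> c0 * ((\<eta> * s) ^ k / fact k) * g (y \<bullet> e + c * real k)"
              unfolding D_def
            proof (intro mult_left_mono g_mono)
              show "1 \<le> x \<bullet> e + c * real (Suc k)" using x c by (simp add: add_increasing2)
              show "x \<bullet> e + c * real (Suc k) \<le> y \<bullet> e + c * real k" using y by (simp add: algebra_simps)
            qed (use c0 \<eta> s in auto)
            also have "\<dots> \<le> v y s" using elim y x c by auto
            finally show ?thesis using True by simp
          qed (use elim in simp)
          then show ?case by (intro mult_left_mono kernel_nonneg)
        qed
      qed
      finally show ?thesis by (simp add: D_def power_mult_distrib ac_simps)
    qed
    have hi: "((\<lambda>s. (c0 * \<eta> ^ Suc k * g (x \<bullet> e + c * real (Suc k))) * (s ^ k / fact k)) has_integral
        (c0 * \<eta> ^ Suc k * g (x \<bullet> e + c * real (Suc k))) * (t ^ Suc k / fact (Suc k))) {0..t}" for x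
      by (intro has_integral_mult_right has_integral_power_div_fact Suc.prems)
    from v_eq[OF Suc.prems] show ?case
    proof (eventually_elim, intro impI)
      fix x assume eq: "v x t = u0 x + integral {0..t} (Z x)" and x: "1 \<le> x \<bullet> e"
      have "(c0 * \<eta> ^ Suc k * g (x \<bullet> e + c * real (Suc k))) * (t ^ Suc k / fact (Suc k)) \<le> integral {0..t} (Z x)"
        using Zb[OF x] by (intro has_integral_le[OF hi integrable_integral[OF Z_int]]) auto
      then have "(c0 * \<eta> ^ Suc k * g (x \<bullet> e + c * real (Suc k))) * (t ^ Suc k / fact (Suc k)) \<le> v x t"
        using u0_nonneg[of x] eq by linarith
      then show "c0 * ((\<eta> * t) ^ Suc k / fact (Suc k)) * g (x \<bullet> e + c * real (Suc k)) \<le> v x t"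
        by (simp only: power_mult_distrib times_divide_eq_left times_divide_eq_right ac_simps)
    qed
  qed
  have "AE x in lebesgue. \<forall>k. 1 \<le> x \<bullet> e \<longrightarrow> c0 * ((\<eta> * 1) ^ k / fact k) * g (x \<bullet> e + c * real k) \<le> v x 1"
    unfolding AE_all_countable using lower[of 1] by simp
  then have "AE x in lebesgue. x \<in> {x. x \<bullet> e \<le> 1}"
  proof eventually_elim
    case (elim x)
    show ?case
    proof (rule ccontr)
      assume "x \<notin> {x. x \<bullet> e \<le> 1}"
      then have x: "1 \<le> x \<bullet> e" by simp
      have "filterlim (\<lambda>k. \<eta> ^ k / fact k * exp ((\<beta> * c) / c * ((1 + c * real k) * ln (1 + c * real k)))) at_top sequentially"
        by (rule supercritical_series_unbounded[OF c(3,1,2) \<eta>])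
      then have "filterlim (\<lambda>k. \<eta> ^ k / fact k * g (1 + c * real k)) at_top sequentially"
        using c by (simp add: g_def)
      then have "\<forall>\<^sub>F k in sequentially. v x 1 / c0 < \<eta> ^ k / fact k * g (1 + c * real k)"
        by (simp add: filterlim_at_top_dense)
      then obtain k where k: "v x 1 / c0 < \<eta> ^ k / fact k * g (1 + c * real k)"
        by (auto simp: eventually_sequentially)
      then have "v x 1 < c0 * (\<eta> ^ k / fact k) * g (1 + c * real k)"
        using c0 by (simp add: pos_divide_less_eq ac_simps)
      also have "\<dots> \<le> c0 * (\<eta> ^ k / fact k) * g (x \<bullet> e + c * real k)"
        using c0 \<eta> x c by (intro mult_left_mono g_mono) auto
      also have "\<dots> \<le> v x 1" using elim x by simp
      finally show False by simp
    qed
  qed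
  moreover have "closed {x. x \<bullet> e \<le> 1}" by (intro closed_Collect_le continuous_intros)
  ultimately have "2 *\<^sub>R e \<in> {x. x \<bullet> e \<le> 1}" by (rule mem_closed_if_AE_lebesgue[rotated])
  then show False using e by (simp add: norm_eq_1)
qed

end

section \<open>Existence by the exponential series\<close>

lemma locally_integrable_if_locally_bounded:
  fixes f :: "'b::euclidean_space \<Rightarrow> real"
  assumes f: "f \<in> borel_measurable borel" and bd: "\<And>R. \<exists>B. \<forall>x. norm x \<le> R \<longrightarrow> \<bar>f x\<bar> \<le> B"
  shows "locally_integrable_on f UNIV"
  unfolding locally_integrable_on_def
proof safe
  fix K :: "'b set" assume K: "compact K"
  then obtain R where R: "\<And>x. x \<in> K \<Longrightarrow> norm x \<le> R"
    using compact_imp_bounded[OF K] unfolding bounded_iff by auto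
  obtain B where B: "\<And>x. norm x \<le> R \<Longrightarrow> \<bar>f x\<bar> \<le> B" using bd by blast
  have Ks: "K \<in> sets borel" using K by (simp add: compact_imp_closed)
  have m: "(\<lambda>x. indicator K x *\<^sub>R f x) \<in> borel_measurable lborel" using f Ks by measurable
  have "integrable lborel (\<lambda>x. indicator K x *\<^sub>R f x)"
  proof (rule Bochner_Integration.integrable_bound[OF _ m])
    show "integrable lborel (\<lambda>x. indicator K x *\<^sub>R B)"
      using K by (intro borel_integrable_compact continuous_on_const)
    show "AE x in lborel. norm (indicator K x *\<^sub>R f x) \<le> norm (indicator K x *\<^sub>R B)"
    proof (rule AE_I2)
      fix x
      show "norm (indicator K x *\<^sub>R f x) \<le> norm (indicator K x *\<^sub>R B)"
        using B[OF R, of x] by (auto split: split_indicator)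
    qed
  qed
  then show "f absolutely_integrable_on K"
    using m by (simp add: set_integrable_def integrable_completion)
qed

lemma locally_integrable_on_subset:
  "locally_integrable_on f UNIV \<Longrightarrow> locally_integrable_on f \<Omega>"
  by (simp add: locally_integrable_on_def)

text \<open>
  The data are taken Borel measurable, which makes the iterates and the series Borel; data that are
  only Lebesgue measurable are replaced by a representative when the solution is extracted.
\<close>

locale dispersal_series = dispersal_kernel J for J :: "'a::euclidean_space \<Rightarrow> real" +
  fixes u0 :: "'a \<Rightarrow> real" and c0 \<alpha> :: real
  assumes u0_borel: "u0 \<in> borel_measurable borel"
    and u0_bound: "\<bar>u0 x\<bar> \<le> c0 * growth_bound \<alpha> (norm x)"
    and c0_pos: "0 < c0" and \<alpha>: "0 < \<alpha>" "\<alpha> < 1"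
begin

definition iter :: "nat \<Rightarrow> 'a \<Rightarrow> real" where
  "iter k = (space_conv J ^^ k) u0"

lemma iter_Suc: "iter (Suc k) x = space_conv J (iter k) x" by (simp add: iter_def)

lemma conv_borel:
  assumes f: "f \<in> borel_measurable borel"
  shows "space_conv J f \<in> borel_measurable borel"
proof -
  note [measurable] = f kernel_borel
  have "space_conv J f = (\<lambda>x. LINT y|lborel. J (x - y) * f y)"
    unfolding space_conv_def by (intro ext integral_completion) measurable
  moreover have "(\<lambda>x. LINT y|lborel. J (x - y) * f y) \<in> borel_measurable borel" by measurable
  ultimately show ?thesis by simp
qed

lemma iter_borel: "iter k \<in> borel_measurable borel"
  by (induction k) (auto simp: iter_def intro: u0_borel conv_borel)

lemma growth_bound_cball:
  "0 \<le> k \<Longrightarrow> norm x \<le> R \<Longrightarrow> c0 * growth_bound \<alpha> (norm x + k) \<le> c0 * growth_bound \<alpha> (R + k)"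
  using \<alpha> c0_pos by (intro mult_left_mono growth_bound_mono) auto

text \<open>
  The hypothesis on \<open>u0\<close>, with the radius enlarged by \<open>1\<close> at each convolution.
\<close>

lemma iter_bound: "\<bar>iter k x\<bar> \<le> c0 * growth_bound \<alpha> (norm x + real k)"
proof (induction k arbitrary: x)
  case 0
  then show ?case using u0_bound by (simp add: iter_def)
next
  case (Suc k)
  have "\<exists>B. \<forall>x. norm x \<le> R \<longrightarrow> \<bar>iter k x\<bar> \<le> B" for R
  proof (intro exI allI impI)
    fix x :: 'a assume "norm x \<le> R"
    then show "\<bar>iter k x\<bar> \<le> c0 * growth_bound \<alpha> (R + real k)"
      using Suc.IH[of x] growth_bound_cball[of "real k" x R] by simp
  qed
  then have loc: "locally_integrable_on (iter k) UNIV"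
    by (rule locally_integrable_if_locally_bounded[OF iter_borel])
  show ?case
    unfolding iter_Suc
  proof (rule conv_abs_le[OF loc], intro AE_I2 impI)
    fix y :: 'a assume "norm y \<le> norm x + 1"
    then have "\<bar>iter k y\<bar> \<le> c0 * growth_bound \<alpha> ((norm x + 1) + real k)"
      using Suc.IH[of y] growth_bound_cball[of "real k" y "norm x + 1"] by simp
    then show "\<bar>iter k y\<bar> \<le> c0 * growth_bound \<alpha> (norm x + real (Suc k))" by (simp add: ac_simps)
  qed
qed

lemma iter_locally_bounded: "norm x \<le> R \<Longrightarrow> \<bar>iter k x\<bar> \<le> c0 * growth_bound \<alpha> (R + real k)"
  using iter_bound[of k x] growth_bound_cball[of "real k" x R] by simp

lemma iter_locally_integrable: "locally_integrable_on (iter k) UNIV"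
  using iter_locally_bounded by (intro locally_integrable_if_locally_bounded[OF iter_borel]) blast

text \<open>
  This is \<open>J\<^bsup>\<star>j\<^esup> \<star> v(t)\<close> for \<open>v(t) = \<Sum>\<^sub>k t\<^sup>k/k! J\<^bsup>\<star>k\<^esup> \<star> u\<^sub>0\<close>.  Both differentiating in \<open>t\<close> and convolving with \<open>J\<close>
  raise \<open>j\<close> by one, which is the equation \<open>v\<^sub>t = J \<star> v\<close>.
\<close>

definition evol :: "nat \<Rightarrow> 'a \<Rightarrow> real \<Rightarrow> real" where
  "evol j x t = (\<Sum>k. iter (k + j) x * (t ^ k / fact k))"

text \<open>
  The \<open>k\<close>-th term of a bound for \<open>evol j\<close> on the ball of radius \<open>R\<close> and for times up to \<open>T\<close>; it is uniform
  in space and time, which gives local boundedness as well as convergence.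
\<close>

definition majorant :: "nat \<Rightarrow> real \<Rightarrow> real \<Rightarrow> nat \<Rightarrow> real" where
  "majorant j R T k = c0 * (T ^ k / fact k * growth_bound \<alpha> (R + real j + real k))"

lemma majorant_summable: "0 \<le> R \<Longrightarrow> 0 \<le> T \<Longrightarrow> summable (majorant j R T)"
  unfolding majorant_def[abs_def] using \<alpha> by (intro summable_mult growth_series_summable) auto

lemma term_le_majorant:
  assumes "norm x \<le> R" "\<bar>t\<bar> \<le> T"
  shows "\<bar>iter (k + j) x * (t ^ k / fact k)\<bar> \<le> majorant j R T k"
proof -
  have "\<bar>t ^ k / fact k\<bar> \<le> T ^ k / fact k"
    using assms by (auto simp: power_abs intro!: divide_right_mono power_mono)
  moreover have "0 \<le> c0 * growth_bound \<alpha> (R + real (k + j))"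
    using c0_pos growth_bound_pos[of \<alpha> "R + real (k + j)"] by simp
  ultimately have "\<bar>iter (k + j) x\<bar> * \<bar>t ^ k / fact k\<bar> \<le> (c0 * growth_bound \<alpha> (R + real (k + j))) * (T ^ k / fact k)"
    using iter_locally_bounded[OF assms(1), of "k + j"] by (intro mult_mono) auto
  then show ?thesis by (simp add: majorant_def abs_mult ac_simps)
qed

lemma evol_summable_norm: "summable (\<lambda>k. \<bar>iter (k + j) x * (t ^ k / fact k)\<bar>)"
  using term_le_majorant[of x "norm x" t "\<bar>t\<bar>"]
  by (intro summable_comparison_test'[OF majorant_summable[of "norm x" "\<bar>t\<bar>" j], of 0]) auto

lemma evol_summable: "summable (\<lambda>k. iter (k + j) x * (t ^ k / fact k))"
  using evol_summable_norm by (rule summable_rabs_cancel)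

lemma evol_bound:
  assumes "norm x \<le> R" "\<bar>t\<bar> \<le> T"
  shows "\<bar>evol j x t\<bar> \<le> suminf (majorant j R T)"
proof -
  have "0 \<le> R" "0 \<le> T" using assms norm_ge_zero[of x] abs_ge_zero[of t] by linarith+
  then have s: "summable (majorant j R T)" by (rule majorant_summable)
  have "\<bar>evol j x t\<bar> \<le> (\<Sum>k. \<bar>iter (k + j) x * (t ^ k / fact k)\<bar>)"
    unfolding evol_def by (rule summable_rabs[OF evol_summable_norm])
  also have "\<dots> \<le> suminf (majorant j R T)"
    by (intro suminf_le term_le_majorant assms evol_summable_norm s)
  finally show ?thesis .
qed

lemma evol_borel: "(\<lambda>p. evol j (fst p) (snd p)) \<in> borel_measurable borel"
proof -
  note [measurable] = iter_borel
  have "(\<lambda>p. evol j (fst p) (snd p)) \<in> borel_measurable (borel \<Otimes>\<^sub>M borel)"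
    unfolding evol_def by measurable
  then show ?thesis by (simp add: borel_prod)
qed

lemma evol_deriv: "(evol j x has_real_derivative evol (Suc j) x t) (at t)"
proof -
  define c where "c k = iter (k + j) x / fact k" for k
  have "((\<lambda>t. \<Sum>k. c k * t ^ k) has_real_derivative (\<Sum>k. diffs c k * t ^ k)) (at t)"
    using evol_summable by (intro termdiffs_strong_converges_everywhere) (simp add: c_def)
  moreover have "(\<lambda>t. \<Sum>k. c k * t ^ k) = evol j x" by (simp add: evol_def c_def fun_eq_iff)
  moreover have "diffs c k = iter (k + Suc j) x / fact k" for k
    unfolding diffs_def c_def by (simp add: divide_simps)
  then have "(\<Sum>k. diffs c k * t ^ k) = evol (Suc j) x t" by (simp add: evol_def)
  ultimately show ?thesis by simp
qed

text \<open>
  The majorant bounds the \<open>L\<^sup>1\<close> norms of the terms and so justifies integrating the series term by term.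
\<close>

lemma evol_conv: "space_conv J (\<lambda>y. evol j y t) x = evol (Suc j) x t"
proof -
  let ?f = "\<lambda>k y. J (x - y) * (iter (k + j) y * (t ^ k / fact k))"
  have scaled: "?f k y = J (x - y) * iter (k + j) y * (t ^ k / fact k)" for k y by simp
  have int: "integrable lebesgue (?f k)" for k
    unfolding scaled using conv_integrable[OF iter_locally_integrable] by (rule integrable_mult_left)
  have "(\<lambda>k. LINT y|lebesgue. ?f k y) sums (LINT y|lebesgue. (\<Sum>k. ?f k y))"
  proof (rule sums_integral[OF int])
    show "AE y in lebesgue. summable (\<lambda>k. norm (?f k y))"
    proof (rule AE_I2)
      fix y
      have "summable (\<lambda>k. J (x - y) * \<bar>iter (k + j) y * (t ^ k / fact k)\<bar>)"
        by (intro summable_mult evol_summable_norm)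
      then show "summable (\<lambda>k. norm (?f k y))" by (simp add: abs_mult kernel_nonneg)
    qed
    have "norm (LINT y|lebesgue. norm (?f k y)) \<le> majorant j (norm x + 1) \<bar>t\<bar> k" for k
    proof -
      have "(LINT y|lebesgue. norm (?f k y)) = space_conv J (\<lambda>y. \<bar>iter (k + j) y * (t ^ k / fact k)\<bar>) x"
        unfolding space_conv_def by (simp add: abs_mult kernel_nonneg)
      moreover have "\<bar>space_conv J (\<lambda>y. \<bar>iter (k + j) y * (t ^ k / fact k)\<bar>) x\<bar> \<le> majorant j (norm x + 1) \<bar>t\<bar> k"
      proof (rule conv_abs_le)
        have "\<exists>B. \<forall>y. norm y \<le> R \<longrightarrow> \<bar>\<bar>iter (k + j) y * (t ^ k / fact k)\<bar>\<bar> \<le> B" for R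
          using term_le_majorant[of _ R t "\<bar>t\<bar>" k j] by (intro exI[of _ "majorant j R \<bar>t\<bar> k"]) simp
        moreover have "(\<lambda>y. \<bar>iter (k + j) y * (t ^ k / fact k)\<bar>) \<in> borel_measurable borel"
          using iter_borel[of "k + j"] by measurable
        ultimately show "locally_integrable_on (\<lambda>y. \<bar>iter (k + j) y * (t ^ k / fact k)\<bar>) UNIV"
          by (intro locally_integrable_if_locally_bounded)
      qed (use term_le_majorant in auto)
      ultimately show ?thesis by simp
    qed
    then show "summable (\<lambda>k. LINT y|lebesgue. norm (?f k y))"
      by (intro summable_comparison_test'[OF majorant_summable[of "norm x + 1" "\<bar>t\<bar>" j], of 0]) auto
  qed
  moreover have "(LINT y|lebesgue. ?f k y) = iter (k + Suc j) x * (t ^ k / fact k)" for k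
    unfolding scaled by (simp add: iter_Suc space_conv_def)
  moreover have "(\<Sum>k. ?f k y) = J (x - y) * evol j y t" for y
    unfolding evol_def by (rule suminf_mult[OF evol_summable])
  ultimately show ?thesis
    unfolding space_conv_def evol_def[of "Suc j"] by (simp add: sums_iff)
qed

lemma evol_0: "evol 0 x 0 = u0 x"
proof -
  have "(\<Sum>k. iter (k + 0) x * (0 ^ k / fact k)) = (\<Sum>k\<in>{0}. iter (k + 0) x * (0 ^ k / fact k))"
    by (rule suminf_finite) auto
  then show ?thesis by (simp add: evol_def iter_def)
qed

definition sol :: "'a \<Rightarrow> real \<Rightarrow> real" where "sol x t = exp (- t) * evol 0 x t"

definition sol_t :: "'a \<Rightarrow> real \<Rightarrow> real" where "sol_t x t = exp (- t) * (evol 1 x t - evol 0 x t)"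

lemma sol_deriv: "(sol x has_real_derivative sol_t x t) (at t)"
  unfolding sol_def[abs_def] sol_t_def
  by (auto intro!: derivative_eq_intros evol_deriv[of 0, simplified] simp: algebra_simps)

lemma sol_conv: "space_conv J (\<lambda>y. sol y t) x = exp (- t) * evol 1 x t"
  unfolding sol_def conv_scale evol_conv by simp

lemma exp_evol_bound:
  assumes "norm x \<le> R" "\<bar>t\<bar> \<le> R"
  shows "\<bar>exp (- t) * evol j x t\<bar> \<le> exp R * suminf (majorant j R R)"
  using evol_bound[OF assms, of j] assms by (auto simp: abs_mult intro!: mult_mono)

lemma exp_evol_locally_integrable:
  "locally_integrable_on (\<lambda>p. exp (- snd p) * evol j (fst p) (snd p)) UNIV"
proof (rule locally_integrable_if_locally_bounded)
  show "(\<lambda>p. exp (- snd p) * evol j (fst p) (snd p)) \<in> borel_measurable borel"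
    by (intro borel_measurable_times evol_borel borel_measurable_continuous_onI continuous_intros)
  show "\<exists>B. \<forall>p. norm p \<le> R \<longrightarrow> \<bar>exp (- snd p) * evol j (fst p) (snd p)\<bar> \<le> B" for R
  proof (intro exI allI impI)
    fix p :: "'a \<times> real" assume "norm p \<le> R"
    then have "norm (fst p) \<le> R" "\<bar>snd p\<bar> \<le> R"
      using norm_fst_le[of "fst p" "snd p"] norm_snd_le[of "snd p" "fst p"] by auto
    then show "\<bar>exp (- snd p) * evol j (fst p) (snd p)\<bar> \<le> exp R * suminf (majorant j R R)"
      by (rule exp_evol_bound)
  qed
qed

lemma sol_slice_locally_integrable: "locally_integrable_on (\<lambda>x. sol x t) UNIV"
proof (rule locally_integrable_if_locally_bounded)
  have "(\<lambda>x. evol 0 (fst (x, t)) (snd (x, t))) \<in> borel_measurable borel"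
    by (rule measurable_compose[OF _ evol_borel]) (auto simp: borel_prod[symmetric])
  then show "(\<lambda>x. sol x t) \<in> borel_measurable borel" unfolding sol_def by simp
  show "\<exists>B. \<forall>x. norm x \<le> R \<longrightarrow> \<bar>sol x t\<bar> \<le> B" for R
    using exp_evol_bound[of _ "max R \<bar>t\<bar>" t 0] unfolding sol_def
    by (intro exI[of _ "exp (max R \<bar>t\<bar>) * suminf (majorant 0 (max R \<bar>t\<bar>) (max R \<bar>t\<bar>))"]) auto
qed

text \<open>
  On a compact set the solution is Lipschitz in time, uniformly in space, since its time derivative is
  locally bounded.
\<close>

lemma sol_continuous_L1loc: "continuous_L1loc sol"
  unfolding continuous_L1loc_def
proof (intro conjI allI impI)
  show "locally_integrable_on (\<lambda>x. sol x t) UNIV" for t by (rule sol_slice_locally_integrable)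
  fix K :: "'a set" and t :: real assume K: "compact K" and t: "0 \<le> t"
  obtain R0 where R0: "\<And>x. x \<in> K \<Longrightarrow> norm x \<le> R0"
    using compact_imp_bounded[OF K] unfolding bounded_iff by auto
  define R where "R = max R0 (t + 1)"
  have R: "norm x \<le> R" if "x \<in> K" for x using R0[OF that] by (simp add: R_def)
  define M where "M = exp R * suminf (majorant 1 R R) + exp R * suminf (majorant 0 R R)"
  have lip: "\<bar>sol x s - sol x t\<bar> \<le> M * \<bar>s - t\<bar>" if x: "x \<in> K" and s: "\<bar>s\<bar> \<le> R" for x s
  proof -
    have "norm (sol x s - sol x t) \<le> M * norm (s - t)"
    proof (rule field_differentiable_bound[where S = "{-R..R}" and f' = "sol_t x"])
      show "(sol x has_real_derivative sol_t x r) (at r within {- R..R})" for r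
        by (rule has_field_derivative_at_within[OF sol_deriv])
      show "norm (sol_t x r) \<le> M" if "r \<in> {- R..R}" for r
      proof -
        have "\<bar>r\<bar> \<le> R" using that by auto
        from exp_evol_bound[OF R[OF x] this, of 1] exp_evol_bound[OF R[OF x] this, of 0] show ?thesis
          by (simp add: sol_t_def M_def right_diff_distrib)
      qed
      show "t \<in> {- R..R}" using t by (auto simp: R_def)
    qed (use s in auto)
    then show ?thesis by simp
  qed
  have absK: "(\<lambda>x. sol x s - sol x t) absolutely_integrable_on K" for s
    using sol_slice_locally_integrable K by (auto simp: locally_integrable_on_def intro!: set_integral_diff)
  have intK: "integrable lebesgue (\<lambda>x. indicator K x *\<^sub>R c)" for c :: real
    using continuous_imp_locally_integrable[OF continuous_on_const[of UNIV c]] K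
    unfolding locally_integrable_on_def set_integrable_def by blast
  have est: "\<bar>LINT x:K|lebesgue. \<bar>sol x s - sol x t\<bar>\<bar> \<le> \<bar>s - t\<bar> * (LINT x:K|lebesgue. M)" if s: "\<bar>s\<bar> \<le> R" for s
  proof -
    have "(LINT x:K|lebesgue. \<bar>sol x s - sol x t\<bar>) \<le> (LINT x:K|lebesgue. M * \<bar>s - t\<bar>)"
      unfolding set_lebesgue_integral_def
    proof (rule integral_mono)
      have "integrable lebesgue (\<lambda>x. \<bar>indicator K x *\<^sub>R (sol x s - sol x t)\<bar>)"
        using absK[of s] unfolding set_integrable_def by (rule integrable_abs)
      then show "integrable lebesgue (\<lambda>x. indicator K x *\<^sub>R \<bar>sol x s - sol x t\<bar>)" by (simp add: abs_mult)
      show "indicator K x *\<^sub>R \<bar>sol x s - sol x t\<bar> \<le> indicator K x *\<^sub>R (M * \<bar>s - t\<bar>)" for x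
        using lip[OF _ s, of x] by (auto split: split_indicator)
    qed (rule intK)
    also have "\<dots> = \<bar>s - t\<bar> * (LINT x:K|lebesgue. M)"
      unfolding set_lebesgue_integral_def by (simp add: mult.assoc[symmetric])
    finally have "(LINT x:K|lebesgue. \<bar>sol x s - sol x t\<bar>) \<le> \<bar>s - t\<bar> * (LINT x:K|lebesgue. M)" .
    moreover have "0 \<le> (LINT x:K|lebesgue. \<bar>sol x s - sol x t\<bar>)"
      unfolding set_lebesgue_integral_def by (intro integral_nonneg_AE) auto
    ultimately show ?thesis by (simp only: abs_of_nonneg)
  qed
  show "((\<lambda>s. LINT x:K|lebesgue. \<bar>sol x s - sol x t\<bar>) \<longlongrightarrow> 0) (at t within {0..})"
  proof (rule Lim_null_comparison)
    show "\<forall>\<^sub>F s in at t within {0..}. norm (LINT x:K|lebesgue. \<bar>sol x s - sol x t\<bar>) \<le> \<bar>s - t\<bar> * (LINT x:K|lebesgue. M)"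
      unfolding eventually_at
    proof (intro exI[of _ 1] conjI ballI impI)
      fix s assume "s \<in> {0..}" "s \<noteq> t \<and> dist s t < 1"
      then have "\<bar>s\<bar> \<le> R" by (auto simp: R_def dist_real_def)
      then show "norm (LINT x:K|lebesgue. \<bar>sol x s - sol x t\<bar>) \<le> \<bar>s - t\<bar> * (LINT x:K|lebesgue. M)"
        using est by simp
    qed simp
    have "((\<lambda>s. \<bar>s - t\<bar> * (LINT x:K|lebesgue. M)) \<longlongrightarrow> \<bar>t - t\<bar> * (LINT x:K|lebesgue. M)) (at t within {0..})"
      by (intro tendsto_intros)
    then show "((\<lambda>s. \<bar>s - t\<bar> * (LINT x:K|lebesgue. M)) \<longlongrightarrow> 0) (at t within {0..})" by simp
  qed
qed

text \<open>
  The solution is classically differentiable in time.  For each \<open>x\<close> the integrand \<open>F(x,\<cdot>)\<close> is the derivative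
  of \<open>sol x \<cdot> \<phi>(x,\<cdot>)\<close>, which has compact support, so its integral is zero; Fubini does the rest.
\<close>

lemma sol_weak_derivative: "weak_time_derivative (\<lambda>(x, t). sol x t) (\<lambda>(x, t). sol_t x t)"
proof -
  let ?u = "\<lambda>(x, t). sol x t" and ?w = "\<lambda>(x, t). sol_t x t"
  have u_eq: "?u = (\<lambda>p. exp (- snd p) * evol 0 (fst p) (snd p))"
    by (auto simp: sol_def fun_eq_iff)
  have w_eq: "?w = (\<lambda>p. exp (- snd p) * evol 1 (fst p) (snd p) - exp (- snd p) * evol 0 (fst p) (snd p))"
    by (auto simp: sol_t_def fun_eq_iff right_diff_distrib)
  have u_loc: "locally_integrable_on ?u UNIV" unfolding u_eq by (rule exp_evol_locally_integrable)
  have w_loc: "locally_integrable_on ?w UNIV"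
    unfolding w_eq using exp_evol_locally_integrable
    by (auto simp: locally_integrable_on_def intro!: set_integral_diff)
  have exp_borel: "(\<lambda>p::'a \<times> real. exp (- snd p)) \<in> borel_measurable borel"
    by (intro borel_measurable_continuous_onI continuous_intros)
  have u_borel: "?u \<in> borel_measurable borel"
    unfolding u_eq by (intro borel_measurable_times evol_borel exp_borel)
  have w_borel: "?w \<in> borel_measurable borel"
    unfolding w_eq by (intro borel_measurable_diff borel_measurable_times evol_borel exp_borel)
  show ?thesis
    unfolding weak_time_derivative_def
  proof (intro conjI allI impI)
    show "locally_integrable_on ?u spacetime" "locally_integrable_on ?w spacetime"
      by (rule locally_integrable_on_subset[OF u_loc] locally_integrable_on_subset[OF w_loc])+
    fix \<phi> :: "'a \<times> real \<Rightarrow> real" assume \<phi>: "test_function spacetime \<phi>"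
    define D where "D p = frechet_derivative \<phi> (at p) (0, 1)" for p
    let ?K = "tsupport \<phi>"
    have Ck: "C_k n \<phi>" for n using \<phi> by (simp add: test_function_def)
    have K: "compact ?K" "?K \<subseteq> spacetime" using \<phi> by (auto simp: test_function_def)
    have diff: "\<phi> differentiable (at p)" for p using Ck[of "Suc 0"] unfolding C_k.simps by blast
    have \<phi>_cont: "continuous_on UNIV \<phi>" using Ck[of 0] by simp
    have D_cont: "continuous_on UNIV D" unfolding D_def using Ck[of "Suc 0"] unfolding C_k.simps by blast
    have \<phi>0: "\<phi> p = 0" if "p \<notin> ?K" for p
      using that closure_subset[of "{x. \<phi> x \<noteq> 0}"] by (auto simp: tsupport_def)
    have D0: "D p = 0" if "p \<notin> ?K" for p
    proof -
      have "(\<phi> has_derivative (\<lambda>_. 0)) (at p)"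
      proof (rule has_derivative_transform_within_open[of "\<lambda>_. 0" _ p UNIV "- ?K"])
        show "open (- ?K)" by (simp add: tsupport_def open_Compl)
      qed (use that \<phi>0 in auto)
      then show ?thesis using frechet_derivative_at[of \<phi> "\<lambda>_. 0" p] by (metis D_def)
    qed
    have iu: "integrable lebesgue (\<lambda>p. indicator ?K p * (?u p * D p))"
      using u_loc K(1) by (intro absolutely_integrable_times_continuous D_cont) (simp_all add: locally_integrable_on_def)
    have iw: "integrable lebesgue (\<lambda>p. indicator ?K p * (?w p * \<phi> p))"
      using w_loc K(1) by (intro absolutely_integrable_times_continuous \<phi>_cont) (simp_all add: locally_integrable_on_def)
    have on_K: "indicator spacetime p *\<^sub>R (?u p * D p) = ?u p * D p"
      "indicator ?K p * (?u p * D p) = ?u p * D p"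
      "indicator spacetime p *\<^sub>R (?w p * \<phi> p) = ?w p * \<phi> p"
      "indicator ?K p * (?w p * \<phi> p) = ?w p * \<phi> p" for p
      using K(2) \<phi>0[of p] D0[of p] by (cases "p \<in> ?K"; auto split: split_indicator)+
    define F where "F p = ?u p * D p + ?w p * \<phi> p" for p
    have Fi: "integrable lebesgue F"
      using Bochner_Integration.integrable_add[OF iu iw] unfolding on_K F_def .
    have F_borel: "F \<in> borel_measurable borel"
      unfolding F_def using \<phi>_cont D_cont
      by (intro borel_measurable_add borel_measurable_times u_borel w_borel borel_measurable_continuous_onI)
    obtain R0 where R0: "\<And>p. p \<in> ?K \<Longrightarrow> norm p \<le> R0"
      using compact_imp_bounded[OF K(1)] unfolding bounded_iff by auto
    define R where "R = \<bar>R0\<bar> + 1"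
    have outside: "(x, t) \<notin> ?K" if "R \<le> \<bar>t\<bar>" for x t
      using R0[of "(x, t)"] norm_snd_le[of t x] that by (auto simp: R_def)
    have inner: "(LINT t|lborel. F (x, t)) = 0" for x
    proof -
      have "(LINT t|lborel. F (x, t)) = (LINT t|lborel. F (x, t) * indicator {-R..R} t)"
      proof (rule Bochner_Integration.integral_cong[OF refl])
        fix t
        show "F (x, t) = F (x, t) * indicator {-R..R} t"
          using \<phi>0[OF outside, of t x] D0[OF outside, of t x]
          by (cases "R \<le> \<bar>t\<bar>") (auto simp: F_def split: split_indicator)
      qed
      also have "\<dots> = sol x R * \<phi> (x, R) - sol x (- R) * \<phi> (x, - R)"
      proof (rule integral_FTC_Icc_real)
        show "- R \<le> R" by (simp add: R_def)
        fix t
        have "((\<lambda>s. \<phi> (x, s)) has_real_derivative D (x, t)) (at t)"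
          unfolding D_def by (rule frechet_time_derivative[OF diff])
        then show "((\<lambda>s. sol x s * \<phi> (x, s)) has_real_derivative F (x, t)) (at t)"
          by (auto intro!: derivative_eq_intros sol_deriv simp: F_def)
        have evol_cont: "isCont (evol j x) t" for j by (rule DERIV_isCont[OF evol_deriv])
        have pair: "isCont (\<lambda>s. g (x, s)) t" if "continuous_on UNIV g" for g :: "'a \<times> real \<Rightarrow> real"
          using continuous_on_compose2[OF that, of UNIV "\<lambda>s. (x, s)"]
          by (auto simp: continuous_on_eq_continuous_at intro!: continuous_intros)
        have "isCont (sol x) t" by (rule DERIV_isCont[OF sol_deriv])
        moreover have "isCont (sol_t x) t"
          unfolding sol_t_def[abs_def] by (intro continuous_intros evol_cont)
        ultimately show "isCont (\<lambda>t. F (x, t)) t"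
          unfolding F_def using pair[OF \<phi>_cont] pair[OF D_cont] by (auto intro!: continuous_intros)
      qed
      also have "\<dots> = 0"
        using \<phi>0[OF outside, of R x] \<phi>0[OF outside, of "- R" x] by (simp add: R_def)
      finally show ?thesis .
    qed
    have "integral\<^sup>L lebesgue F = integral\<^sup>L (lborel \<Otimes>\<^sub>M lborel) F"
      using F_borel by (simp add: integral_completion lborel_prod)
    also have "\<dots> = (LINT x|lborel. LINT t|lborel. F (x, t))"
      using Fi F_borel by (intro lborel_pair.integral_fst'[symmetric]) (simp add: integrable_completion lborel_prod)
    also have "\<dots> = 0" by (simp add: inner)
    finally have "(LINT p|lebesgue. ?u p * D p) + (LINT p|lebesgue. ?w p * \<phi> p) = 0"
      using Bochner_Integration.integral_add[OF iu iw] unfolding on_K F_def by simp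
    then show "(LINT p:spacetime|lebesgue. ?u p * frechet_derivative \<phi> (at p) (0, 1))
        = - (LINT p:spacetime|lebesgue. ?w p * \<phi> p)"
      unfolding set_lebesgue_integral_def D_def[symmetric] on_K by simp
  qed
qed

lemma sol_strong_solution: "strong_solution J u0 sol"
  unfolding strong_solution_def
proof (intro conjI exI[of _ "\<lambda>(x, t). sol_t x t"])
  show "continuous_L1loc sol" by (rule sol_continuous_L1loc)
  have "(\<lambda>(x, t). space_conv J (\<lambda>y. sol y t) x) = (\<lambda>p. exp (- snd p) * evol 1 (fst p) (snd p))"
    by (auto simp: sol_conv fun_eq_iff)
  then show "locally_integrable_on (\<lambda>(x, t). space_conv J (\<lambda>y. sol y t) x) spacetime"
    by (simp add: locally_integrable_on_subset[OF exp_evol_locally_integrable])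
  show "weak_time_derivative (\<lambda>(x, t). sol x t) (\<lambda>(x, t). sol_t x t)" by (rule sol_weak_derivative)
  show "AE (x, t) in lebesgue. 0 < t \<longrightarrow> (case (x, t) of (x, t) \<Rightarrow> sol_t x t) = space_conv J (\<lambda>y. sol y t) x - sol x t"
    unfolding sol_conv unfolding sol_t_def sol_def right_diff_distrib by simp
  show "AE x in lebesgue. sol x 0 = u0 x" by (simp add: sol_def evol_0)
qed

end

context dispersal_kernel
begin

lemma solution_exists:
  assumes \<alpha>: "0 < \<alpha>" "\<alpha> < 1" and c0: "0 < c0" and u0: "u0 \<in> borel_measurable lebesgue"
    and bound: "\<And>x. \<bar>u0 x\<bar> \<le> c0 * growth \<alpha> x"
  shows "\<exists>u. strong_solution J u0 u"
proof -
  obtain u1 where u1: "u1 \<in> borel_measurable lborel" "AE x in lborel. u0 x = u1 x"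
    using completion_ex_borel_measurable_real[of u0 lborel] u0 by auto
  let ?G = "\<lambda>x. c0 * growth_bound \<alpha> (norm x)"
  \<comment> \<open>Cutting off at the growth bound changes the representative on a null set only and makes the
    bound hold at every point.\<close>
  define u2 where "u2 x = (if \<bar>u1 x\<bar> \<le> ?G x then u1 x else 0)" for x
  have G: "0 \<le> ?G x" for x :: 'a using c0 growth_bound_pos[of \<alpha> "norm x"] by simp
  interpret dispersal_series J u2 c0 \<alpha>
  proof
    have [measurable]: "u1 \<in> borel_measurable borel" using u1 by simp
    show "u2 \<in> borel_measurable borel" unfolding u2_def growth_bound_def by measurable
    show "\<bar>u2 x\<bar> \<le> ?G x" for x using G[of x] by (simp add: u2_def)
  qed (use \<alpha> c0 in auto)
  have "AE x in lebesgue. u0 x = u1 x" using u1(2) by (rule AE_completion)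
  then have "AE x in lebesgue. u2 x = u0 x"
  proof eventually_elim
    case (elim x)
    have "\<bar>u0 x\<bar> \<le> ?G x"
      using bound[of x] growth_le_growth_bound[of \<alpha> x] \<alpha> c0
      by (meson less_imp_le mult_left_mono order_trans)
    with elim show ?case by (simp add: u2_def)
  qed
  moreover have "AE x in lebesgue. sol x 0 = u2 x"
    using sol_strong_solution by (simp add: strong_solution_def)
  ultimately have "AE x in lebesgue. sol x 0 = u0 x" by eventually_elim simp
  then have "strong_solution J u0 sol"
    using sol_strong_solution unfolding strong_solution_def by blast
  then show ?thesis by blast
qed

end


theorem theorem1p1:
  fixes J u0 :: "'a::euclidean_space \<Rightarrow> real" and c0 :: real
  assumes "conv_kernel J"
    and "radially_symmetric J"
    and "tsupport J = cball 0 1"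
    and "u0 \<in> borel_measurable lebesgue"
    and "locally_bounded_on u0 UNIV"
    and "c0 > 0"
  shows "(\<forall>\<alpha>. 0 < \<alpha> \<and> \<alpha> < 1 \<and> (\<forall>x. \<bar>u0 x\<bar> \<le> c0 * growth \<alpha> x) \<longrightarrow>
            (\<exists>u. strong_solution J u0 u)) \<and>
         (\<forall>\<beta>. \<beta> > 1 \<and> (\<forall>x. u0 x \<ge> c0 * growth \<beta> x) \<longrightarrow>
            \<not> (\<exists>u. strong_solution J u0 u \<and> (\<forall>t\<ge>0. AE x in lebesgue. u x t \<ge> 0))) \<and>
         (\<forall>\<alpha>. 0 < \<alpha> \<and> \<alpha> < 1 \<longrightarrow>
            (\<forall>u v. strong_solution J u0 u \<and>
               (\<exists>C. locally_bounded_on C {0..} \<and>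
                  (\<forall>t\<ge>0. AE x in lebesgue. \<bar>u x t\<bar> \<le> C t * growth \<alpha> x)) \<and>
               strong_solution J u0 v \<and>
               (\<exists>C. locally_bounded_on C {0..} \<and>
                  (\<forall>t\<ge>0. AE x in lebesgue. \<bar>v x t\<bar> \<le> C t * growth \<alpha> x)) \<longrightarrow>
               (\<forall>t\<ge>0. AE x in lebesgue. u x t = v x t)))"
proof -
  interpret dispersal_kernel J
  proof
    show "continuous_on UNIV J" "0 \<le> J z" "J (- z) = J z" "has_bochner_integral lebesgue J 1" for z
      using assms(1) by (auto simp: conv_kernel_def)
    show "J z = 0" if "1 < norm z" for z
    proof (rule ccontr)
      assume "J z \<noteq> 0"
      then have "z \<in> tsupport J" using closure_subset[of "{z. J z \<noteq> 0}"] by (auto simp: tsupport_def)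
      with assms(3) that show False by simp
    qed
  qed
  show ?thesis
  proof (intro conjI allI impI)
    fix \<alpha> assume "0 < \<alpha> \<and> \<alpha> < 1 \<and> (\<forall>x. \<bar>u0 x\<bar> \<le> c0 * growth \<alpha> x)"
    then show "\<exists>u. strong_solution J u0 u" using solution_exists[of \<alpha> c0 u0] assms by blast
  next
    fix \<beta> assume "\<beta> > 1 \<and> (\<forall>x. u0 x \<ge> c0 * growth \<beta> x)"
    then show "\<not> (\<exists>u. strong_solution J u0 u \<and> (\<forall>t\<ge>0. AE x in lebesgue. u x t \<ge> 0))"
      using no_nonneg_solution[OF assms(3,6), of \<beta> u0] by blast
  next
    fix \<alpha> u v t
    assume "0 < \<alpha> \<and> \<alpha> < 1" and h: "strong_solution J u0 u \<and>
        (\<exists>C. locally_bounded_on C {0..} \<and> (\<forall>t\<ge>0. AE x in lebesgue. \<bar>u x t\<bar> \<le> C t * growth \<alpha> x)) \<and>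
        strong_solution J u0 v \<and>
        (\<exists>C. locally_bounded_on C {0..} \<and> (\<forall>t\<ge>0. AE x in lebesgue. \<bar>v x t\<bar> \<le> C t * growth \<alpha> x))"
      and "(0::real) \<le> t"
    then have \<alpha>: "0 < \<alpha>" "\<alpha> < 1" and t: "0 \<le> t" by auto
    from h obtain Cu Cv where
      "locally_bounded_on Cu {0..}" "\<And>t. 0 \<le> t \<Longrightarrow> AE x in lebesgue. \<bar>u x t\<bar> \<le> Cu t * growth \<alpha> x"
      "locally_bounded_on Cv {0..}" "\<And>t. 0 \<le> t \<Longrightarrow> AE x in lebesgue. \<bar>v x t\<bar> \<le> Cv t * growth \<alpha> x"
      by blast
    with h \<alpha> t show "AE x in lebesgue. u x t = v x t"
      by (intro solution_unique[of \<alpha> u0 u Cu v Cv]) auto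
  qed
qed

end
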